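(* Let $R,\widetilde R\in\mathcal K_{(0,1]}$. Then $d_{\mathrm{uni}}(R,\widetilde R)=0$ if and only if $R$ and $\widetilde R$ are unitarily equivalent. In particular, $d_{\mathrm{uni}}$ induces a metric on the set of unitary equivalence classes $\mathsf K_{(0,1]}$.
   Context: Let $\mathsf{HS}$ be a fixed set of separable infinite-dimensional Hilbert spaces. For a Hilbert space $\mathcal H$, let $\mathcal K_{(0,1]}(\mathcal H)$ be the set of all compact self-adjoint injective operators $R\colon\mathcal H\to\mathcal H$ with spectrum contained in $[0,1]$, and set $\mathcal K_{(0,1]}:=\bigcup_{\mathcal H\in\mathsf{HS}}\mathcal K_{(0,1]}(\mathcal H)$. Two operators $R$ on $\mathcal H$ and $\widetilde R$ on $\widetilde{\mathcal H}$ are unitarily equivalent, $R\sim\widetilde R$, if $\widetilde R=URU^*$ for some unitary $U\colon\mathcal H\to\widetilde{\mathcal H}$; $\mathsf K_{(0,1]}:=\mathcal K_{(0,1]}/{\sim}$. Define $$d_{\mathrm{uni}}(R,\widetilde R):=\inf\{\|\widetilde R-URU^*\| : U\colon\mathcal H\to\widetilde{\mathcal H}\text{ unitary}\},$$ where $\|\cdot\|$ is the operator norm. *)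

theory Defs
  imports "HOL-Analysis.Analysis" "HOL-Algebra.Module" "HOL-Algebra.Algebraic_Closure_Type"
begin

text \<open>Hilbert spaces are explicit structures (complex modules with an inner product), so that a
  set of different Hilbert spaces can be quantified over. As usual for \<^type>\<open>module\<close>, the
  multiplication and the unit of the underlying ring record carry no meaning.\<close>

abbreviation complex_ring :: "complex ring" where
  "complex_ring \<equiv> ring_of_type_algebra"

record 'a hilbert = "(complex, 'a) module" +
  cinner :: "'a \<Rightarrow> 'a \<Rightarrow> complex"

definition hnorm :: "'a hilbert \<Rightarrow> 'a \<Rightarrow> real" where
  "hnorm H x = sqrt (Re (cinner H x x))"

text \<open>The locale \<^locale>\<open>Metric_space\<close> demands symmetry and non-negativity also outside the
  carrier, hence the guard.\<close>

definition hdist :: "'a hilbert \<Rightarrow> 'a \<Rightarrow> 'a \<Rightarrow> real" where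
  "hdist H x y = (if x \<in> carrier H \<and> y \<in> carrier H then hnorm H (x \<ominus>\<^bsub>H\<^esub> y) else 0)"

abbreviation htopology :: "'a hilbert \<Rightarrow> 'a topology" where
  "htopology H \<equiv> Metric_space.mtopology (carrier H) (hdist H)"

locale hilbert_space = module complex_ring H for H :: "'a hilbert" (structure) +
  assumes cinner_add: "\<lbrakk>x \<in> carrier H; y \<in> carrier H; z \<in> carrier H\<rbrakk>
      \<Longrightarrow> cinner H (x \<oplus> y) z = cinner H x z + cinner H y z"
    and cinner_smult: "\<lbrakk>x \<in> carrier H; y \<in> carrier H\<rbrakk>
      \<Longrightarrow> cinner H (c \<odot> x) y = c * cinner H x y"
    and cinner_commute: "\<lbrakk>x \<in> carrier H; y \<in> carrier H\<rbrakk>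
      \<Longrightarrow> cinner H y x = cnj (cinner H x y)"
    and cinner_pos: "\<lbrakk>x \<in> carrier H; x \<noteq> \<zero>\<rbrakk> \<Longrightarrow> 0 < Re (cinner H x x)"
    and complete: "Metric_space.mcomplete (carrier H) (hdist H)"

definition infinite_dimensional :: "'a hilbert \<Rightarrow> bool" where
  "infinite_dimensional H \<longleftrightarrow>
     (\<forall>B. finite B \<and> B \<subseteq> carrier H
        \<longrightarrow> (\<lambda>S. submodule S complex_ring H) hull B \<noteq> carrier H)"

definition separable_inf_dim_hilbert :: "'a hilbert \<Rightarrow> bool" where
  "separable_inf_dim_hilbert H \<longleftrightarrow>
     hilbert_space H \<and> separable_space (htopology H) \<and> infinite_dimensional H"

text \<open>Operators are extensional functions, i.e. \<^const>\<open>undefined\<close> outside the carrier of their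
  domain, so that equality of operators is equality of functions.\<close>

definition linear_op :: "'a hilbert \<Rightarrow> 'a hilbert \<Rightarrow> ('a \<Rightarrow> 'a) \<Rightarrow> bool" where
  "linear_op H K T \<longleftrightarrow> T \<in> carrier H \<rightarrow>\<^sub>E carrier K \<and>
     (\<forall>x\<in>carrier H. \<forall>y\<in>carrier H. T (x \<oplus>\<^bsub>H\<^esub> y) = T x \<oplus>\<^bsub>K\<^esub> T y) \<and>
     (\<forall>c. \<forall>x\<in>carrier H. T (c \<odot>\<^bsub>H\<^esub> x) = c \<odot>\<^bsub>K\<^esub> T x)"

definition bounded_op :: "'a hilbert \<Rightarrow> 'a hilbert \<Rightarrow> ('a \<Rightarrow> 'a) \<Rightarrow> bool" where
  "bounded_op H K T \<longleftrightarrow> linear_op H K T \<and>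
     (\<exists>C. \<forall>x\<in>carrier H. hnorm K (T x) \<le> C * hnorm H x)"

definition op_norm :: "'a hilbert \<Rightarrow> 'a hilbert \<Rightarrow> ('a \<Rightarrow> 'a) \<Rightarrow> real" where
  "op_norm H K T = (SUP x\<in>{x \<in> carrier H. hnorm H x \<le> 1}. hnorm K (T x))"

definition op_diff :: "'a hilbert \<Rightarrow> 'a hilbert \<Rightarrow> ('a \<Rightarrow> 'a) \<Rightarrow> ('a \<Rightarrow> 'a) \<Rightarrow> 'a \<Rightarrow> 'a" where
  "op_diff H K S T = (\<lambda>x\<in>carrier H. S x \<ominus>\<^bsub>K\<^esub> T x)"

definition is_adjoint ::
  "'a hilbert \<Rightarrow> 'a hilbert \<Rightarrow> ('a \<Rightarrow> 'a) \<Rightarrow> ('a \<Rightarrow> 'a) \<Rightarrow> bool" where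
  "is_adjoint H K T S \<longleftrightarrow> bounded_op H K T \<and> bounded_op K H S \<and>
     (\<forall>x\<in>carrier H. \<forall>y\<in>carrier K. cinner K (T x) y = cinner H x (S y))"

definition adjoint_op :: "'a hilbert \<Rightarrow> 'a hilbert \<Rightarrow> ('a \<Rightarrow> 'a) \<Rightarrow> 'a \<Rightarrow> 'a" where
  "adjoint_op H K T = (THE S. is_adjoint H K T S)"

definition self_adjoint :: "'a hilbert \<Rightarrow> ('a \<Rightarrow> 'a) \<Rightarrow> bool" where
  "self_adjoint H T \<longleftrightarrow> is_adjoint H H T T"

definition compact_op :: "'a hilbert \<Rightarrow> 'a hilbert \<Rightarrow> ('a \<Rightarrow> 'a) \<Rightarrow> bool" where
  "compact_op H K T \<longleftrightarrow> bounded_op H K T \<and>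
     compactin (htopology K)
       (htopology K closure_of (T ` {x \<in> carrier H. hnorm H x \<le> 1}))"

definition unitary_op :: "'a hilbert \<Rightarrow> 'a hilbert \<Rightarrow> ('a \<Rightarrow> 'a) \<Rightarrow> bool" where
  "unitary_op H K U \<longleftrightarrow> linear_op H K U \<and> U ` carrier H = carrier K \<and>
     (\<forall>x\<in>carrier H. \<forall>y\<in>carrier H. cinner K (U x) (U y) = cinner H x y)"

definition op_spectrum :: "'a hilbert \<Rightarrow> ('a \<Rightarrow> 'a) \<Rightarrow> complex set" where
  "op_spectrum H T = {z. \<not> (\<exists>S. bounded_op H H S \<and>
     (\<forall>x\<in>carrier H. S (T x \<ominus>\<^bsub>H\<^esub> z \<odot>\<^bsub>H\<^esub> x) = x \<and> T (S x) \<ominus>\<^bsub>H\<^esub> z \<odot>\<^bsub>H\<^esub> S x = x))}"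

definition K01 :: "'a hilbert \<Rightarrow> ('a \<Rightarrow> 'a) set" where
  "K01 H = {R. compact_op H H R \<and> self_adjoint H R \<and> inj_on R (carrier H) \<and>
     op_spectrum H R \<subseteq> complex_of_real ` {0..1}}"

text \<open>An operator is paired with the space it acts on: spaces in \<open>HS\<close> may share a carrier.\<close>

type_synonym 'a hop = "'a hilbert \<times> ('a \<Rightarrow> 'a)"

definition K01_all :: "'a hilbert set \<Rightarrow> 'a hop set" where
  "K01_all HS = (SIGMA H:HS. K01 H)"

definition conj_op :: "'a hilbert \<Rightarrow> 'a hilbert \<Rightarrow> ('a \<Rightarrow> 'a) \<Rightarrow> ('a \<Rightarrow> 'a) \<Rightarrow> 'a \<Rightarrow> 'a" where
  "conj_op H K U R = compose (carrier K) U (compose (carrier K) R (adjoint_op H K U))"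

definition unitarily_equivalent :: "'a hop \<Rightarrow> 'a hop \<Rightarrow> bool" where
  "unitarily_equivalent = (\<lambda>(H, R) (K, S). \<exists>U. unitary_op H K U \<and> S = conj_op H K U R)"

definition d_uni :: "'a hop \<Rightarrow> 'a hop \<Rightarrow> real" where
  "d_uni = (\<lambda>(H, R) (K, S).
     (INF U\<in>{U. unitary_op H K U}. op_norm K K (op_diff K K S (conj_op H K U R))))"

definition unitary_rel :: "'a hilbert set \<Rightarrow> ('a hop \<times> 'a hop) set" where
  "unitary_rel HS =
     {(p, q). p \<in> K01_all HS \<and> q \<in> K01_all HS \<and> unitarily_equivalent p q}"

definition K01_classes :: "'a hilbert set \<Rightarrow> 'a hop set set" where
  "K01_classes HS = K01_all HS // unitary_rel HS"

end

theory Submission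
  imports Defs "HOL-Library.Diagonal_Subsequence"
begin

text \<open>The only substantial point is that vanishing distance forces unitary equivalence. Suppose that
  \<open>U\<^sub>n\<close> are unitaries with \<open>\<parallel>S U\<^sub>n - U\<^sub>n R\<parallel> \<rightarrow> 0\<close>. Instead of comparing ordered eigenvalues, the proof
  obtains an intertwining unitary directly as a strong limit of a subsequence, so that no spectral
  theory enters.

  For a fixed \<open>x\<close> the vectors \<open>U\<^sub>n x\<close> are bounded, so by compactness of \<open>S\<close> the vectors
  \<open>S U\<^sub>n x\<close> converge along a subsequence, and \<open>U\<^sub>n R x\<close> with them. A diagonal subsequence serves all
  \<open>x\<close> from a countable dense set at once. An injective self-adjoint \<open>R\<close> has dense range
  (\<open>dense_range_self_adjoint\<close>), and the \<open>U\<^sub>n\<close> are isometries; hence \<open>U\<^sub>n\<close> converges strongly along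
  this subsequence (\<open>almost_intertwining_Cauchy_subseq\<close>). The adjoints \<open>U\<^sub>n\<^sup>*\<close> almost intertwine \<open>S\<close> and
  \<open>R\<close>, so after a further choice of subsequence they converge strongly as well. A strong limit \<open>V\<close>
  of unitaries whose adjoints also converge strongly is unitary (\<open>strong_limit_unitary\<close>), and
  \<open>S V = V R\<close> follows in the limit (\<open>exists_intertwining_unitary\<close>).

  Symmetry and the triangle inequality hold because inverting a unitary does not increase its defect
  \<open>\<parallel>S U - U R\<parallel>\<close> and composing unitaries adds their defects at most. The infimum is
  meaningful only if some unitary exists between any two of the spaces; this is where orthonormal
  bases come in (\<open>exists_unitary\<close>). Finally, a pseudometric becomes a metric on the classes of points
  at distance zero (\<open>quotient_of_pseudometric\<close>).\<close>

section \<open>Geometry of the inner product\<close>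

context hilbert_space
begin

lemma smult_in_carrier [simp, intro]: "x \<in> carrier H \<Longrightarrow> c \<odot> x \<in> carrier H"
  using smult_closed[of c x] by (simp add: ring_of_type_algebra_def)

lemma cinner_add_right:
  "\<lbrakk>x \<in> carrier H; y \<in> carrier H; z \<in> carrier H\<rbrakk>
    \<Longrightarrow> cinner H x (y \<oplus> z) = cinner H x y + cinner H x z"
  by (metis add.m_closed cinner_add cinner_commute complex_cnj_add)

lemma cinner_smult_right:
  "\<lbrakk>x \<in> carrier H; y \<in> carrier H\<rbrakk> \<Longrightarrow> cinner H x (c \<odot> y) = cnj c * cinner H x y"
  by (metis smult_in_carrier cinner_smult cinner_commute complex_cnj_mult)

lemma cinner_zero_left [simp]: "x \<in> carrier H \<Longrightarrow> cinner H \<zero> x = 0"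
  using cinner_add[of "\<zero>" "\<zero>" x] by simp

lemma cinner_zero_right [simp]: "x \<in> carrier H \<Longrightarrow> cinner H x \<zero> = 0"
  using cinner_add_right[of x "\<zero>" "\<zero>"] by simp

lemma diff_add_cancel: "\<lbrakk>x \<in> carrier H; y \<in> carrier H\<rbrakk> \<Longrightarrow> x \<ominus> y \<oplus> y = x"
  by (simp add: a_minus_def a_assoc l_neg)

lemma cinner_diff:
  assumes "x \<in> carrier H" "y \<in> carrier H" "z \<in> carrier H"
  shows "cinner H (x \<ominus> y) z = cinner H x z - cinner H y z"
proof -
  have "cinner H (x \<ominus> y \<oplus> y) z = cinner H (x \<ominus> y) z + cinner H y z"
    using assms by (simp add: cinner_add)
  then show ?thesis
    using assms by (simp add: diff_add_cancel)
qed

lemma cinner_diff_right: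
  "\<lbrakk>x \<in> carrier H; y \<in> carrier H; z \<in> carrier H\<rbrakk>
    \<Longrightarrow> cinner H x (y \<ominus> z) = cinner H x y - cinner H x z"
  by (metis minus_closed cinner_diff cinner_commute complex_cnj_diff)

lemmas cinner_linear =
  cinner_add cinner_add_right cinner_diff cinner_diff_right cinner_smult cinner_smult_right

lemma cinner_finsum:
  "\<lbrakk>finite A; f \<in> A \<rightarrow> carrier H; y \<in> carrier H\<rbrakk>
    \<Longrightarrow> cinner H (finsum H f A) y = (\<Sum>a\<in>A. cinner H (f a) y)"
  by (induction A rule: finite_induct) (auto simp: cinner_add)

lemma cinner_finsum_right:
  "\<lbrakk>finite A; f \<in> A \<rightarrow> carrier H; y \<in> carrier H\<rbrakk>
    \<Longrightarrow> cinner H y (finsum H f A) = (\<Sum>a\<in>A. cinner H y (f a))"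
  by (induction A rule: finite_induct) (auto simp: cinner_add_right)

lemma cinner_self_nonneg: "x \<in> carrier H \<Longrightarrow> 0 \<le> Re (cinner H x x)"
  using cinner_pos[of x] by (cases "x = \<zero>") auto

lemma hnorm_nonneg [simp]: "x \<in> carrier H \<Longrightarrow> 0 \<le> hnorm H x"
  by (simp add: hnorm_def cinner_self_nonneg)

lemma hnorm_sq: "x \<in> carrier H \<Longrightarrow> (hnorm H x)\<^sup>2 = Re (cinner H x x)"
  by (simp add: hnorm_def cinner_self_nonneg)

lemma cinner_self: "x \<in> carrier H \<Longrightarrow> cinner H x x = of_real ((hnorm H x)\<^sup>2)"
  using cinner_commute[of x x] by (simp add: hnorm_sq complex_eq_iff)

lemma hnorm_zero [simp]: "hnorm H \<zero> = 0"
  by (simp add: hnorm_def)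

lemma hnorm_eq_0_iff: "x \<in> carrier H \<Longrightarrow> hnorm H x = 0 \<longleftrightarrow> x = \<zero>"
  using cinner_pos[of x] hnorm_sq[of x] by (cases "x = \<zero>") auto

lemma hnorm_smult: "x \<in> carrier H \<Longrightarrow> hnorm H (c \<odot> x) = cmod c * hnorm H x"
proof -
  assume x: "x \<in> carrier H"
  have "cinner H (c \<odot> x) (c \<odot> x) = of_real ((cmod c * hnorm H x)\<^sup>2)"
    using x by (simp add: cinner_linear cinner_self[OF x] complex_norm_square power_mult_distrib
        mult.assoc del: of_real_power)
  then show ?thesis
    using x by (simp add: hnorm_def[of H "c \<odot> x"])
qed

lemma minus_eq_zero_iff:
  "\<lbrakk>x \<in> carrier H; y \<in> carrier H\<rbrakk> \<Longrightarrow> x \<ominus> y = \<zero> \<longleftrightarrow> x = y"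
  using diff_add_cancel[of x y] by (auto simp: a_minus_def r_neg)

text \<open>Pairing with an arbitrary vector turns an identity between vectors into an identity between
  complex numbers, which the arithmetic of fields settles; below this replaces rearrangements by the
  module laws.\<close>

lemma eqI_cinner:
  assumes "x \<in> carrier H" "y \<in> carrier H"
    and "\<And>z. z \<in> carrier H \<Longrightarrow> cinner H x z = cinner H y z"
  shows "x = y"
proof -
  have "cinner H (x \<ominus> y) (x \<ominus> y) = 0"
    using assms by (simp add: cinner_diff)
  then show ?thesis
    using assms hnorm_eq_0_iff[of "x \<ominus> y"] by (simp add: hnorm_def minus_eq_zero_iff)
qed

lemma minus_eq_add_smult:
  "x \<in> carrier H \<Longrightarrow> y \<in> carrier H \<Longrightarrow> x \<ominus> y = x \<oplus> (- 1) \<odot> y"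
  by (rule eqI_cinner) (auto simp: cinner_linear)

lemma zero_smult: "x \<in> carrier H \<Longrightarrow> 0 \<odot> x = \<zero>"
  by (rule eqI_cinner) (auto simp: cinner_linear)

text \<open>The coefficient is that of the orthogonal projection onto the line through \<open>y\<close>, so this is
  Pythagoras' theorem. Since a square is not negative, it yields the Cauchy-Schwarz inequality; and it
  shows that a vector which no multiple of \<open>y\<close> can shorten is orthogonal to \<open>y\<close>.\<close>

lemma hnorm_sq_residual:
  assumes x: "x \<in> carrier H" and y: "y \<in> carrier H" and nz: "y \<noteq> \<zero>"
  shows "(hnorm H (x \<ominus> (cinner H x y / of_real ((hnorm H y)\<^sup>2)) \<odot> y))\<^sup>2 =
    (hnorm H x)\<^sup>2 - (cmod (cinner H x y))\<^sup>2 / (hnorm H y)\<^sup>2"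
proof -
  define n where "n = (hnorm H y)\<^sup>2"
  have n: "n > 0"
    using nz hnorm_eq_0_iff[OF y] by (simp add: n_def)
  define c where "c = cinner H x y / of_real n"
  have yx: "cinner H y x = cnj (cinner H x y)"
    using x y by (rule cinner_commute)
  have "cinner H (x \<ominus> c \<odot> y) (x \<ominus> c \<odot> y) =
      of_real ((hnorm H x)\<^sup>2) - cinner H x y * cnj (cinner H x y) / of_real n"
    using x y n by (simp add: cinner_linear cinner_self[OF x] cinner_self[OF y] yx c_def
        n_def[symmetric] field_simps del: of_real_power)
  also have "cinner H x y * cnj (cinner H x y) = of_real ((cmod (cinner H x y))\<^sup>2)"
    by (rule complex_norm_square[symmetric])
  finally show ?thesis
    using x y unfolding c_def n_def
    by (simp add: hnorm_sq[of "x \<ominus> _"] del: of_real_power flip: of_real_divide of_real_diff)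
qed

lemma Cauchy_Schwarz:
  assumes x: "x \<in> carrier H" and y: "y \<in> carrier H"
  shows "cmod (cinner H x y) \<le> hnorm H x * hnorm H y"
proof (cases "y = \<zero>")
  case False
  then have "hnorm H y > 0"
    using hnorm_eq_0_iff[OF y] hnorm_nonneg[OF y] by linarith
  moreover have "(cmod (cinner H x y))\<^sup>2 / (hnorm H y)\<^sup>2 \<le> (hnorm H x)\<^sup>2"
    using hnorm_sq_residual[OF x y False] by (metis diff_ge_0_iff_ge zero_le_power2)
  ultimately have "(cmod (cinner H x y))\<^sup>2 \<le> (hnorm H x * hnorm H y)\<^sup>2"
    by (simp add: field_simps power_mult_distrib)
  then show ?thesis
    using x y by (meson hnorm_nonneg mult_nonneg_nonneg power2_le_imp_le)
qed (use x in simp)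

lemma hnorm_triangle:
  assumes x: "x \<in> carrier H" and y: "y \<in> carrier H"
  shows "hnorm H (x \<oplus> y) \<le> hnorm H x + hnorm H y"
proof -
  have "(hnorm H (x \<oplus> y))\<^sup>2 = (hnorm H x)\<^sup>2 + (hnorm H y)\<^sup>2 + 2 * Re (cinner H x y)"
    using x y cinner_commute[OF x y] by (simp add: hnorm_sq cinner_linear)
  also have "Re (cinner H x y) \<le> hnorm H x * hnorm H y"
    using Cauchy_Schwarz[OF x y] complex_Re_le_cmod order_trans by blast
  finally have "(hnorm H (x \<oplus> y))\<^sup>2 \<le> (hnorm H x + hnorm H y)\<^sup>2"
    by (simp add: power2_sum)
  then show ?thesis
    using x y by (meson add_nonneg_nonneg hnorm_nonneg power2_le_imp_le)
qed

lemma hnorm_diff_le: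
  "x \<in> carrier H \<Longrightarrow> y \<in> carrier H \<Longrightarrow> hnorm H (x \<ominus> y) \<le> hnorm H x + hnorm H y"
  using hnorm_triangle[of x "(- 1) \<odot> y"] by (simp add: minus_eq_add_smult hnorm_smult)

lemma hnorm_minus_commute:
  "\<lbrakk>x \<in> carrier H; y \<in> carrier H\<rbrakk> \<Longrightarrow> hnorm H (x \<ominus> y) = hnorm H (y \<ominus> x)"
  by (simp add: hnorm_def cinner_linear)

lemma hnorm_diff_triangle:
  assumes "x \<in> carrier H" "y \<in> carrier H" "z \<in> carrier H"
  shows "hnorm H (x \<ominus> z) \<le> hnorm H (x \<ominus> y) + hnorm H (y \<ominus> z)"
proof -
  have "x \<ominus> z = (x \<ominus> y) \<oplus> (y \<ominus> z)"
    by (rule eqI_cinner) (use assms in \<open>auto simp: cinner_linear\<close>)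
  then show ?thesis
    using hnorm_triangle[of "x \<ominus> y" "y \<ominus> z"] assms by simp
qed

lemma Metric_space_hdist: "Metric_space (carrier H) (hdist H)"
proof
  fix x y
  show "0 \<le> hdist H x y"
    by (simp add: hdist_def)
  show "hdist H x y = hdist H y x"
    using hnorm_minus_commute[of x y] by (simp add: hdist_def)
  show "hdist H x y = 0 \<longleftrightarrow> x = y" if "x \<in> carrier H" "y \<in> carrier H"
    using that by (simp add: hdist_def hnorm_eq_0_iff minus_eq_zero_iff)
  show "hdist H x z \<le> hdist H x y + hdist H y z"
    if "x \<in> carrier H" "y \<in> carrier H" "z \<in> carrier H" for z
    using that by (simp add: hdist_def hnorm_diff_triangle)
qed

end

sublocale hilbert_space \<subseteq> hmet: Metric_space "carrier H" "hdist H"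
  by (rule Metric_space_hdist)

section \<open>Limits of sequences\<close>

text \<open>Convergence in \<open>htopology\<close> ignores what a sequence does outside the carrier at finitely
  many places. Asking all terms to lie in the carrier allows estimates of norms term by term.\<close>

definition hlimit :: "'a hilbert \<Rightarrow> (nat \<Rightarrow> 'a) \<Rightarrow> 'a \<Rightarrow> bool" where
  "hlimit H s l \<longleftrightarrow> range s \<subseteq> carrier H \<and> l \<in> carrier H \<and>
     (\<lambda>n. hnorm H (s n \<ominus>\<^bsub>H\<^esub> l)) \<longlonglongrightarrow> 0"

definition hCauchy :: "'a hilbert \<Rightarrow> (nat \<Rightarrow> 'a) \<Rightarrow> bool" where
  "hCauchy H s \<longleftrightarrow> range s \<subseteq> carrier H \<and>
     (\<forall>e>0. \<exists>N. \<forall>m\<ge>N. \<forall>n\<ge>N. hnorm H (s m \<ominus>\<^bsub>H\<^esub> s n) < e)"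

context hilbert_space
begin

lemma hlimit_in_carrier: "hlimit H s l \<Longrightarrow> s n \<in> carrier H" "hlimit H s l \<Longrightarrow> l \<in> carrier H"
  by (auto simp: hlimit_def)

lemma hlimit_iff_limitin:
  "hlimit H s l \<longleftrightarrow> range s \<subseteq> carrier H \<and> limitin (htopology H) s l sequentially"
proof -
  have "(\<lambda>n. hnorm H (s n \<ominus> l)) \<longlonglongrightarrow> 0 \<longleftrightarrow>
      (\<forall>e>0. \<exists>N. \<forall>n\<ge>N. s n \<in> carrier H \<and> hdist H (s n) l < e)"
    if "range s \<subseteq> carrier H" "l \<in> carrier H"
    using that by (simp add: LIMSEQ_iff hdist_def image_subset_iff)
  then show ?thesis
    by (auto simp: hlimit_def hmet.limit_metric_sequentially)
qed

lemma hCauchy_iff_MCauchy: "hCauchy H s \<longleftrightarrow> hmet.MCauchy s"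
  by (auto simp: hCauchy_def hmet.MCauchy_def hdist_def image_subset_iff)

lemma hCauchy_imp_hlimit: "hCauchy H s \<Longrightarrow> \<exists>l. hlimit H s l"
  using complete unfolding hmet.mcomplete_def hCauchy_iff_MCauchy hlimit_iff_limitin
  by (auto simp: hmet.MCauchy_def)

lemma hlimit_imp_hCauchy: "hlimit H s l \<Longrightarrow> hCauchy H s"
  using hmet.convergent_imp_MCauchy unfolding hCauchy_iff_MCauchy hlimit_iff_limitin by blast

lemma hlimit_unique: "hlimit H s l \<Longrightarrow> hlimit H s l' \<Longrightarrow> l = l'"
  using hmet.limitin_metric_unique[of s l sequentially l']
  by (auto simp: hlimit_iff_limitin)

lemma hlimit_const: "x \<in> carrier H \<Longrightarrow> hlimit H (\<lambda>n. x) x"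
  by (simp add: hlimit_def minus_eq_zero_iff[THEN iffD2])

lemma hlimitI:
  assumes "\<And>n. s n \<in> carrier H" "l \<in> carrier H"
    and "\<And>n. hnorm H (s n \<ominus> l) \<le> b n" "b \<longlonglongrightarrow> 0"
  shows "hlimit H s l"
  unfolding hlimit_def
  using assms by (auto intro!: tendsto_sandwich[OF _ _ tendsto_const assms(4)])

lemma hlimit_add:
  assumes s: "hlimit H s l" and t: "hlimit H t k"
  shows "hlimit H (\<lambda>n. s n \<oplus> t n) (l \<oplus> k)"
proof (rule hlimitI)
  note [simp] = hlimit_in_carrier[OF s] hlimit_in_carrier[OF t]
  fix n
  have "s n \<oplus> t n \<ominus> (l \<oplus> k) = (s n \<ominus> l) \<oplus> (t n \<ominus> k)"
    by (rule eqI_cinner) (auto simp: cinner_linear)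
  then show "hnorm H (s n \<oplus> t n \<ominus> (l \<oplus> k)) \<le> hnorm H (s n \<ominus> l) + hnorm H (t n \<ominus> k)"
    by (simp add: hnorm_triangle)
  show "(\<lambda>n. hnorm H (s n \<ominus> l) + hnorm H (t n \<ominus> k)) \<longlonglongrightarrow> 0"
    using s t tendsto_add unfolding hlimit_def by fastforce
qed (auto simp: hlimit_in_carrier[OF s] hlimit_in_carrier[OF t])

lemma hlimit_smult:
  assumes s: "hlimit H s l"
  shows "hlimit H (\<lambda>n. c \<odot> s n) (c \<odot> l)"
proof (rule hlimitI)
  note [simp] = hlimit_in_carrier[OF s]
  fix n
  have "c \<odot> s n \<ominus> c \<odot> l = c \<odot> (s n \<ominus> l)"
    by (rule eqI_cinner) (auto simp: cinner_linear algebra_simps)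
  then show "hnorm H (c \<odot> s n \<ominus> c \<odot> l) \<le> cmod c * hnorm H (s n \<ominus> l)"
    by (simp add: hnorm_smult)
  show "(\<lambda>n. cmod c * hnorm H (s n \<ominus> l)) \<longlonglongrightarrow> 0"
    using s unfolding hlimit_def by (auto intro: tendsto_mult_right_zero)
qed (auto simp: hlimit_in_carrier[OF s])

lemma hlimit_diff:
  assumes s: "hlimit H s l" and t: "hlimit H t k"
  shows "hlimit H (\<lambda>n. s n \<ominus> t n) (l \<ominus> k)"
proof -
  note [simp] = hlimit_in_carrier[OF s] hlimit_in_carrier[OF t]
  show ?thesis
    using hlimit_add[OF s hlimit_smult[OF t, of "- 1"]] by (simp add: minus_eq_add_smult)
qed

lemma hCauchyD:
  "hCauchy H s \<Longrightarrow> e > 0 \<Longrightarrow> \<exists>N. \<forall>m\<ge>N. \<forall>n\<ge>N. hnorm H (s m \<ominus> s n) < e"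
  by (simp add: hCauchy_def)

lemma hCauchy_subseq: "hCauchy H s \<Longrightarrow> strict_mono r \<Longrightarrow> hCauchy H (s \<circ> r)"
  unfolding hCauchy_def image_subset_iff comp_def by (meson UNIV_I le_trans seq_suble)

lemma hCauchy_shift:
  assumes "range s \<subseteq> carrier H" "hCauchy H (s \<circ> (+) k)"
  shows "hCauchy H s"
  unfolding hCauchy_def
proof (intro conjI allI impI)
  fix e :: real
  assume "e > 0"
  then obtain N where N: "\<And>m n. m \<ge> N \<Longrightarrow> n \<ge> N \<Longrightarrow> hnorm H (s (k + m) \<ominus> s (k + n)) < e"
    using hCauchyD[OF assms(2)] unfolding comp_def by meson
  have "hnorm H (s m \<ominus> s n) < e" if "m \<ge> N + k" "n \<ge> N + k" for m n
    using N[of "m - k" "n - k"] that by (simp add: le_diff_conv2)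
  then show "\<exists>N. \<forall>m\<ge>N. \<forall>n\<ge>N. hnorm H (s m \<ominus> s n) < e"
    by blast
qed (use assms in blast)

lemma hlimit_perturb:
  assumes s: "hlimit H s l" and t: "\<And>n. t n \<in> carrier H"
    and close: "(\<lambda>n. hnorm H (s n \<ominus> t n)) \<longlonglongrightarrow> 0"
  shows "hlimit H t l"
proof (rule hlimitI)
  note [simp] = hlimit_in_carrier[OF s] t
  show "hnorm H (t n \<ominus> l) \<le> hnorm H (s n \<ominus> t n) + hnorm H (s n \<ominus> l)" for n
    using hnorm_diff_triangle[of "t n" "s n" l] hnorm_minus_commute[of "t n" "s n"] by simp
  show "(\<lambda>n. hnorm H (s n \<ominus> t n) + hnorm H (s n \<ominus> l)) \<longlonglongrightarrow> 0"
    using tendsto_add[OF close, of "\<lambda>n. hnorm H (s n \<ominus> l)" 0] s by (simp add: hlimit_def)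
qed (use t hlimit_in_carrier[OF s] in auto)

lemma hCauchy_perturb:
  assumes "hCauchy H s" "\<And>n. t n \<in> carrier H" "(\<lambda>n. hnorm H (s n \<ominus> t n)) \<longlonglongrightarrow> 0"
  shows "hCauchy H t"
  using hCauchy_imp_hlimit[OF assms(1)] hlimit_perturb[OF _ assms(2,3)] hlimit_imp_hCauchy by blast

lemma hnorm_reverse_triangle:
  assumes "x \<in> carrier H" "y \<in> carrier H"
  shows "\<bar>hnorm H x - hnorm H y\<bar> \<le> hnorm H (x \<ominus> y)"
proof -
  have "x \<ominus> \<zero> = x" "y \<ominus> \<zero> = y"
    using assms by (simp_all add: a_minus_def)
  then show ?thesis
    using hnorm_diff_triangle[of x y \<zero>] hnorm_diff_triangle[of y x \<zero>] assms
      hnorm_minus_commute[of x y] by auto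
qed

lemma hlimit_hnorm:
  assumes s: "hlimit H s l"
  shows "(\<lambda>n. hnorm H (s n)) \<longlonglongrightarrow> hnorm H l"
proof -
  have "(\<lambda>n. hnorm H (s n) - hnorm H l) \<longlonglongrightarrow> 0"
    by (rule Lim_null_comparison[of _ "\<lambda>n. hnorm H (s n \<ominus> l)"])
      (use s in \<open>auto simp: hlimit_def image_subset_iff hnorm_reverse_triangle\<close>)
  then show ?thesis
    by (simp add: LIM_zero_iff)
qed

lemma hlimit_cinner_left:
  assumes s: "hlimit H s l" and y: "y \<in> carrier H"
  shows "(\<lambda>n. cinner H (s n) y) \<longlonglongrightarrow> cinner H l y"
proof -
  note [simp] = hlimit_in_carrier[OF s]
  have "(\<lambda>n. cinner H (s n \<ominus> l) y) \<longlonglongrightarrow> 0"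
  proof (rule Lim_null_comparison)
    show "\<forall>\<^sub>F n in sequentially. norm (cinner H (s n \<ominus> l) y) \<le> hnorm H (s n \<ominus> l) * hnorm H y"
      using y by (simp add: Cauchy_Schwarz)
    show "(\<lambda>n. hnorm H (s n \<ominus> l) * hnorm H y) \<longlonglongrightarrow> 0"
      using s unfolding hlimit_def by (auto intro: tendsto_mult_left_zero)
  qed
  then show ?thesis
    using y by (simp add: cinner_diff LIM_zero_iff)
qed

lemma hlimit_cinner:
  assumes s: "hlimit H s l" and t: "hlimit H t k"
  shows "(\<lambda>n. cinner H (s n) (t n)) \<longlonglongrightarrow> cinner H l k"
proof -
  note [simp] = hlimit_in_carrier[OF s] hlimit_in_carrier[OF t]
  have "(\<lambda>n. cinner H (s n) (t n \<ominus> k)) \<longlonglongrightarrow> 0"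
  proof (rule Lim_null_comparison)
    show "\<forall>\<^sub>F n in sequentially.
        norm (cinner H (s n) (t n \<ominus> k)) \<le> hnorm H (s n) * hnorm H (t n \<ominus> k)"
      by (simp add: Cauchy_Schwarz)
    show "(\<lambda>n. hnorm H (s n) * hnorm H (t n \<ominus> k)) \<longlonglongrightarrow> 0"
      using tendsto_mult[OF hlimit_hnorm[OF s]] t unfolding hlimit_def by fastforce
  qed
  moreover have "cinner H (s n) (t n \<ominus> k) = cinner H (s n) (t n) - cinner H (s n) k" for n
    by (simp add: cinner_diff_right)
  ultimately have "(\<lambda>n. (cinner H (s n) (t n) - cinner H (s n) k) + cinner H (s n) k)
      \<longlonglongrightarrow> 0 + cinner H l k"
    using hlimit_cinner_left[OF s, of k] by (intro tendsto_add) auto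
  then show ?thesis by simp
qed

end

section \<open>Approximation by points of a subspace\<close>

context hilbert_space
begin

text \<open>A sequence in \<open>S\<close> whose distances to \<open>x\<close> approach the infimum \<open>d\<close> is Cauchy by the
  parallelogram law. Its limit \<open>y\<close> need not lie in \<open>S\<close>, but \<open>x - y\<close> cannot be shortened by adding
  members of \<open>S\<close>. So \<open>x - y\<close> is orthogonal to \<open>S\<close>, hence zero, and the sequence converges to
  \<open>x\<close>.\<close>

lemma exists_near_in_subspace:
  assumes S: "submodule S complex_ring H"
    and triv: "\<And>z. z \<in> carrier H \<Longrightarrow> (\<forall>s\<in>S. cinner H z s = 0) \<Longrightarrow> z = \<zero>"
    and x: "x \<in> carrier H" and e: "e > 0"
  shows "\<exists>s\<in>S. hnorm H (x \<ominus> s) < e"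
proof -
  note S_car = subsetD[OF submoduleE(1)[OF S]]
  have S_smult: "c \<odot> s \<in> S" if "s \<in> S" for c s
    using submoduleE(4)[OF S, of c s] that by (simp add: ring_of_type_algebra_def)
  note S_add = submoduleE(5)[OF S]
  define d where "d = (INF s\<in>S. hnorm H (x \<ominus> s))"
  have bdd: "bdd_below ((\<lambda>s. hnorm H (x \<ominus> s)) ` S)"
    by (rule bdd_belowI[of _ 0]) (use x S_car in auto)
  have d_le: "d \<le> hnorm H (x \<ominus> s)" if "s \<in> S" for s
    unfolding d_def using bdd that by (rule cINF_lower)
  have d_nonneg: "0 \<le> d"
    unfolding d_def using x S_car submoduleE(2)[OF S] by (intro cINF_greatest) auto
  define \<delta> where "\<delta> n = inverse (real (Suc n))" for n
  have \<delta>_pos: "\<delta> n > 0" "\<delta> n \<le> 1" for n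
    by (simp_all add: \<delta>_def inverse_le_1_iff)
  have \<delta>_lim: "\<delta> \<longlonglongrightarrow> 0"
    unfolding \<delta>_def by (rule LIMSEQ_inverse_real_of_nat)
  have "\<exists>s\<in>S. hnorm H (x \<ominus> s) < d + \<delta> n" for n
    using cINF_less_iff[OF _ bdd, of "d + \<delta> n"] submoduleE(2)[OF S] \<delta>_pos(1)[of n]
    by (simp add: d_def[symmetric])
  then obtain s where s: "\<And>n. s n \<in> S" "\<And>n. hnorm H (x \<ominus> s n) < d + \<delta> n"
    by metis
  note [simp] = x S_car[OF s(1)]
  have near: "(hnorm H (x \<ominus> s k))\<^sup>2 \<le> d\<^sup>2 + (2 * d + 1) * \<delta> k" for k
  proof -
    have "(hnorm H (x \<ominus> s k))\<^sup>2 \<le> (d + \<delta> k)\<^sup>2"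
      using s(2)[of k] by (intro power_mono) auto
    also have "\<dots> \<le> d\<^sup>2 + (2 * d + 1) * \<delta> k"
      using \<delta>_pos[of k] mult_left_le[of "\<delta> k" "\<delta> k"] by (simp add: power2_eq_square algebra_simps)
    finally show ?thesis .
  qed
  \<comment> \<open>The parallelogram law, with the midpoint of \<open>s m\<close> and \<open>s n\<close> at distance at least \<open>d\<close>.\<close>
  have sq: "(hnorm H (s m \<ominus> s n))\<^sup>2 \<le> 2 * (2 * d + 1) * (\<delta> m + \<delta> n)" for m n
  proof -
    let ?mid = "(1 / 2) \<odot> (s m \<oplus> s n)"
    have "(hnorm H (s m \<ominus> s n))\<^sup>2 =
        2 * (hnorm H (x \<ominus> s m))\<^sup>2 + 2 * (hnorm H (x \<ominus> s n))\<^sup>2 - 4 * (hnorm H (x \<ominus> ?mid))\<^sup>2"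
      by (simp add: hnorm_sq cinner_linear algebra_simps)
    moreover have "d\<^sup>2 \<le> (hnorm H (x \<ominus> ?mid))\<^sup>2"
      by (intro power_mono d_le S_smult S_add s d_nonneg)
    ultimately show ?thesis
      using near[of m] near[of n] by (simp add: algebra_simps)
  qed
  have "hCauchy H s"
    unfolding hCauchy_def
  proof (intro conjI allI impI)
    fix \<epsilon> :: real
    assume \<epsilon>: "\<epsilon> > 0"
    define q where "q = \<epsilon>\<^sup>2 / (4 * (2 * d + 1))"
    have "q > 0"
      using \<epsilon> d_nonneg by (simp add: q_def)
    then obtain N where N: "\<And>n. n \<ge> N \<Longrightarrow> \<delta> n < q"
      using order_tendstoD(2)[OF \<delta>_lim] unfolding eventually_sequentially by meson
    have "hnorm H (s m \<ominus> s n) < \<epsilon>" if "m \<ge> N" "n \<ge> N" for m n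
    proof -
      have "\<delta> m + \<delta> n < 2 * q"
        using N[OF that(1)] N[OF that(2)] by simp
      then have "2 * (2 * d + 1) * (\<delta> m + \<delta> n) < 2 * (2 * d + 1) * (2 * q)"
        using d_nonneg by (intro mult_strict_left_mono) auto
      also have "\<dots> = \<epsilon>\<^sup>2"
        using d_nonneg by (simp add: q_def field_simps)
      finally have "(hnorm H (s m \<ominus> s n))\<^sup>2 < \<epsilon>\<^sup>2"
        using sq[of m n] by linarith
      then show ?thesis
        using \<epsilon> by (simp add: power2_less_imp_less)
    qed
    then show "\<exists>N. \<forall>m\<ge>N. \<forall>n\<ge>N. hnorm H (s m \<ominus> s n) < \<epsilon>"
      by blast
  qed auto
  then obtain y where y: "hlimit H s y"
    using hCauchy_imp_hlimit by blast
  note [simp] = hlimit_in_carrier(2)[OF y]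
  define z where "z = x \<ominus> y"
  have z_car [simp]: "z \<in> carrier H"
    by (simp add: z_def)
  have "hnorm H z \<le> d"
  proof (rule LIMSEQ_le)
    show "(\<lambda>n. hnorm H (x \<ominus> s n)) \<longlonglongrightarrow> hnorm H z"
      unfolding z_def by (intro hlimit_hnorm hlimit_diff hlimit_const y) simp
    show "(\<lambda>n. d + \<delta> n) \<longlonglongrightarrow> d"
      using tendsto_add[OF tendsto_const \<delta>_lim] by simp
  qed (use s(2) less_imp_le in blast)
  have minimal: "d \<le> hnorm H (z \<ominus> c \<odot> t)" if t: "t \<in> S" for c t
  proof (rule LIMSEQ_le_const)
    note [simp] = S_car[OF t]
    have "z \<ominus> c \<odot> t = x \<ominus> (y \<oplus> c \<odot> t)"
      by (rule eqI_cinner) (auto simp: z_def cinner_linear)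
    then show "(\<lambda>n. hnorm H (x \<ominus> (s n \<oplus> c \<odot> t))) \<longlonglongrightarrow> hnorm H (z \<ominus> c \<odot> t)"
      by (auto intro!: hlimit_hnorm hlimit_diff hlimit_add hlimit_const y)
    show "\<exists>N. \<forall>n\<ge>N. d \<le> hnorm H (x \<ominus> (s n \<oplus> c \<odot> t))"
      using d_le S_add S_smult s(1) t by blast
  qed
  have "cinner H z t = 0" if t: "t \<in> S" for t
  proof (cases "t = \<zero>")
    case False
    note [simp] = S_car[OF t]
    have "(hnorm H z)\<^sup>2 \<le> (hnorm H (z \<ominus> (cinner H z t / of_real ((hnorm H t)\<^sup>2)) \<odot> t))\<^sup>2"
      using minimal[OF t] \<open>hnorm H z \<le> d\<close> by (intro power_mono) (auto intro: order_trans)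
    then have "(cmod (cinner H z t))\<^sup>2 / (hnorm H t)\<^sup>2 \<le> 0"
      using hnorm_sq_residual[of z t] False by (simp del: power_mono_iff)
    moreover have "hnorm H t \<noteq> 0"
      using False hnorm_eq_0_iff[of t] by simp
    ultimately show ?thesis
      by (simp add: divide_le_0_iff)
  qed simp
  then have "z = \<zero>"
    using triv z_car by blast
  then have "x = y"
    by (simp add: z_def minus_eq_zero_iff)
  then obtain n where "hnorm H (s n \<ominus> x) < e"
    using y e order_tendstoD(2)[of "\<lambda>n. hnorm H (s n \<ominus> y)" 0 sequentially e]
    by (auto simp: hlimit_def eventually_sequentially)
  then show ?thesis
    using s(1) hnorm_minus_commute[of "s n" x] by auto
qed

lemma exists_dense_sequence:
  assumes "separable_space (htopology H)"
  shows "\<exists>D. range D \<subseteq> carrier H \<and>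
    (\<forall>x\<in>carrier H. \<forall>e>0. \<exists>n::nat. hnorm H (x \<ominus> D n) < e)"
proof -
  obtain C where C: "countable C" "C \<subseteq> carrier H" "htopology H closure_of C = carrier H"
    using assms unfolding separable_space_def by auto
  have near: "\<exists>y\<in>C. hnorm H (x \<ominus> y) < e" if "x \<in> carrier H" "e > 0" for x e
    using that C unfolding hmet.metric_closure_of by (force simp: hdist_def)
  have "C \<noteq> {}"
    using near[of \<zero> 1] by auto
  then have "range (from_nat_into C) = C"
    using C(1) by (rule range_from_nat_into)
  then have "range (from_nat_into C) \<subseteq> carrier H \<and>
      (\<forall>x\<in>carrier H. \<forall>e>0. \<exists>n. hnorm H (x \<ominus> from_nat_into C n) < e)"
    using C(2) near by (metis (no_types, lifting) imageE)
  then show ?thesis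
    by blast
qed

end

section \<open>Orthonormal bases\<close>

definition orthonormal :: "'a hilbert \<Rightarrow> (nat \<Rightarrow> 'a) \<Rightarrow> bool" where
  "orthonormal H e \<longleftrightarrow> range e \<subseteq> carrier H \<and> (\<forall>m n. cinner H (e m) (e n) = of_bool (m = n))"

definition orthonormal_basis :: "'a hilbert \<Rightarrow> (nat \<Rightarrow> 'a) \<Rightarrow> bool" where
  "orthonormal_basis H e \<longleftrightarrow> orthonormal H e \<and>
     (\<forall>z\<in>carrier H. (\<forall>n. cinner H z (e n) = 0) \<longrightarrow> z = \<zero>\<^bsub>H\<^esub>)"

definition partial_sum :: "'a hilbert \<Rightarrow> (nat \<Rightarrow> 'a) \<Rightarrow> (nat \<Rightarrow> complex) \<Rightarrow> nat \<Rightarrow> 'a" where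
  "partial_sum H e c N = finsum H (\<lambda>n. c n \<odot>\<^bsub>H\<^esub> e n) {..<N}"

context hilbert_space
begin

lemma partial_sum_in_carrier [simp]: "orthonormal H e \<Longrightarrow> partial_sum H e c N \<in> carrier H"
  unfolding partial_sum_def orthonormal_def by (auto intro!: finsum_closed)

lemma cinner_partial_sum_right:
  "\<lbrakk>orthonormal H e; x \<in> carrier H\<rbrakk>
    \<Longrightarrow> cinner H x (partial_sum H e c N) = (\<Sum>n<N. cnj (c n) * cinner H x (e n))"
  unfolding partial_sum_def orthonormal_def
  by (subst cinner_finsum_right) (auto simp: cinner_smult_right image_subset_iff)

lemma cinner_partial_sum_basis:
  assumes "orthonormal H e"
  shows "cinner H (partial_sum H e c N) (e n) = (if n < N then c n else 0)"
proof -
  have "cinner H (partial_sum H e c N) (e n) = (\<Sum>m<N. if m = n then c m else 0)"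
    using assms unfolding partial_sum_def orthonormal_def
    by (subst cinner_finsum) (auto simp: cinner_smult image_subset_iff intro!: sum.cong)
  then show ?thesis
    by simp
qed

lemma cinner_partial_sums:
  "orthonormal H e \<Longrightarrow> M \<le> N \<Longrightarrow> cinner H (partial_sum H e b N) (partial_sum H e c M) =
    (\<Sum>n<M. b n * cnj (c n))"
  by (simp add: cinner_partial_sum_right cinner_partial_sum_basis mult.commute)

lemma hnorm_sq_partial_sum:
  "orthonormal H e \<Longrightarrow> (hnorm H (partial_sum H e c N))\<^sup>2 = (\<Sum>n<N. (cmod (c n))\<^sup>2)"
  by (simp add: hnorm_sq cinner_partial_sums complex_norm_square[symmetric] del: of_real_power)

lemma hnorm_sq_partial_sum_diff:
  assumes e: "orthonormal H e" and "M \<le> N"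
  shows "(hnorm H (partial_sum H e c N \<ominus> partial_sum H e c M))\<^sup>2 =
    (\<Sum>n<N. (cmod (c n))\<^sup>2) - (\<Sum>n<M. (cmod (c n))\<^sup>2)"
proof -
  have "cinner H (partial_sum H e c M) (partial_sum H e c N) = (\<Sum>n<M. cnj (c n) * c n)"
    using cinner_partial_sums[OF e \<open>M \<le> N\<close>, of c c] cinner_commute[of "partial_sum H e c N"
      "partial_sum H e c M"] e by simp
  then show ?thesis
    using assms by (simp add: hnorm_sq cinner_diff cinner_diff_right cinner_partial_sums
      complex_norm_square[symmetric] mult.commute[of "cnj _"] del: of_real_power)
qed

lemma Bessel:
  assumes e: "orthonormal H e" and x: "x \<in> carrier H"
  shows "(\<Sum>n<N. (cmod (cinner H x (e n)))\<^sup>2) \<le> (hnorm H x)\<^sup>2"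
proof -
  define p where "p = partial_sum H e (\<lambda>n. cinner H x (e n)) N"
  have p: "p \<in> carrier H"
    using e by (simp add: p_def)
  have "cinner H x p = of_real (\<Sum>n<N. (cmod (cinner H x (e n)))\<^sup>2)"
    using e x by (simp add: p_def cinner_partial_sum_right complex_norm_square mult.commute
        del: of_real_power)
  moreover from this have "cinner H p x = of_real (\<Sum>n<N. (cmod (cinner H x (e n)))\<^sup>2)"
    using cinner_commute[OF x p] by simp
  moreover have "Re (cinner H p p) = (\<Sum>n<N. (cmod (cinner H x (e n)))\<^sup>2)"
    using hnorm_sq_partial_sum[OF e, of "\<lambda>n. cinner H x (e n)" N] p
    by (simp add: hnorm_sq p_def)
  ultimately show ?thesis
    using cinner_self_nonneg[of "x \<ominus> p"] x p by (simp add: cinner_diff cinner_diff_right hnorm_sq)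
qed

text \<open>The squared distance of two partial sums is the difference of the corresponding partial sums
  of \<open>\<Sum>|c\<^sub>n|\<^sup>2\<close>, a convergent series, so completeness provides the limit. The coefficient at \<open>e n\<close>
  is constant along the partial sums from the index \<open>n + 1\<close> on.\<close>

lemma Riesz_Fischer:
  assumes e: "orthonormal H e" and bound: "\<And>N. (\<Sum>n<N. (cmod (c n))\<^sup>2) \<le> B"
  shows "\<exists>l. hlimit H (partial_sum H e c) l \<and> (\<forall>n. cinner H l (e n) = c n)"
proof -
  let ?s = "partial_sum H e c"
  define S where "S N = (\<Sum>n<N. (cmod (c n))\<^sup>2)" for N
  have "convergent S"
    unfolding S_def summable_iff_convergent[symmetric]
    by (rule bounded_imp_summable[of _ B])
      (use bound in \<open>auto simp del: sum.lessThan_Suc simp flip: lessThan_Suc_atMost\<close>)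
  then have "Cauchy S"
    by (rule convergent_Cauchy)
  have "hCauchy H ?s"
    unfolding hCauchy_def
  proof (intro conjI allI impI)
    fix \<epsilon> :: real
    assume \<epsilon>: "\<epsilon> > 0"
    obtain N where N: "\<And>m n. m \<ge> N \<Longrightarrow> n \<ge> N \<Longrightarrow> \<bar>S m - S n\<bar> < \<epsilon>\<^sup>2"
      using CauchyD[OF \<open>Cauchy S\<close>, of "\<epsilon>\<^sup>2"] \<epsilon> by auto
    have *: "(hnorm H (?s m \<ominus> ?s n))\<^sup>2 = \<bar>S m - S n\<bar>" for m n
    proof (cases "n \<le> m")
      case True
      then show ?thesis
        using hnorm_sq_partial_sum_diff[OF e True, of c] unfolding S_def
        by (metis abs_of_nonneg zero_le_power2)
    next
      case False
      then have "(hnorm H (?s n \<ominus> ?s m))\<^sup>2 = \<bar>S n - S m\<bar>"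
        using hnorm_sq_partial_sum_diff[OF e, of m n c] unfolding S_def
        by (metis abs_of_nonneg zero_le_power2 nat_le_linear)
      then show ?thesis
        using e hnorm_minus_commute[of "?s m" "?s n"] by (simp add: abs_minus_commute)
    qed
    have "hnorm H (?s m \<ominus> ?s n) < \<epsilon>" if "m \<ge> N" "n \<ge> N" for m n
      using *[of m n] N[OF that] \<epsilon> by (simp add: power2_less_imp_less)
    then show "\<exists>N. \<forall>m\<ge>N. \<forall>n\<ge>N. hnorm H (?s m \<ominus> ?s n) < \<epsilon>"
      by blast
  qed (use e in auto)
  then obtain l where l: "hlimit H ?s l"
    using hCauchy_imp_hlimit by blast
  moreover have "cinner H l (e n) = c n" for n
  proof (rule LIMSEQ_unique)
    show "(\<lambda>N. cinner H (?s N) (e n)) \<longlonglongrightarrow> cinner H l (e n)"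
      using l e by (intro hlimit_cinner_left) (auto simp: orthonormal_def)
    show "(\<lambda>N. cinner H (?s N) (e n)) \<longlonglongrightarrow> c n"
      using e by (intro tendsto_eventually eventually_sequentiallyI[of "Suc n"])
        (simp add: cinner_partial_sum_basis)
  qed
  ultimately show ?thesis
    by blast
qed

lemma orthonormal_basis_eqI:
  assumes "orthonormal_basis H e" "x \<in> carrier H" "y \<in> carrier H"
    and "\<And>n. cinner H x (e n) = cinner H y (e n)"
  shows "x = y"
proof -
  have "\<forall>n. cinner H (x \<ominus> y) (e n) = 0"
    using assms by (auto simp: orthonormal_basis_def orthonormal_def cinner_diff image_subset_iff)
  then have "x \<ominus> y = \<zero>"
    using assms by (auto simp: orthonormal_basis_def)
  then show ?thesis
    using assms by (simp add: minus_eq_zero_iff)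
qed

text \<open>The Fourier series of a vector converges to a vector with the same coefficients, which is the
  vector itself. The formula is then the limit of the one for partial sums.\<close>

lemma Parseval:
  assumes e: "orthonormal_basis H e" and x: "x \<in> carrier H" and y: "y \<in> carrier H"
  shows "(\<lambda>n. cinner H x (e n) * cnj (cinner H y (e n))) sums cinner H x y"
proof -
  have on: "orthonormal H e"
    using e by (simp add: orthonormal_basis_def)
  have lim: "hlimit H (partial_sum H e (\<lambda>n. cinner H z (e n))) z" if z: "z \<in> carrier H" for z
  proof -
    obtain l where l: "hlimit H (partial_sum H e (\<lambda>n. cinner H z (e n))) l"
      "\<And>n. cinner H l (e n) = cinner H z (e n)"
      using Riesz_Fischer[OF on Bessel[OF on z]] by blast
    moreover from this have "l = z"
      using orthonormal_basis_eqI[OF e] z hlimit_in_carrier(2)[OF l(1)] by blast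
    ultimately show ?thesis
      by simp
  qed
  show ?thesis
    using hlimit_cinner[OF lim[OF x] lim[OF y]] on
    by (simp add: sums_def cinner_partial_sums)
qed

text \<open>Zorn's lemma: a nonzero vector orthogonal to a maximal orthonormal set could be normalised
  and added to the set.\<close>

lemma exists_maximal_orthonormal_set:
  "\<exists>B. B \<subseteq> carrier H \<and> (\<forall>x\<in>B. \<forall>y\<in>B. cinner H x y = of_bool (x = y)) \<and>
     (\<forall>z\<in>carrier H. (\<forall>b\<in>B. cinner H z b = 0) \<longrightarrow> z = \<zero>)"
proof -
  define A where
    "A = {B. B \<subseteq> carrier H \<and> (\<forall>x\<in>B. \<forall>y\<in>B. cinner H x y = of_bool (x = y))}"
  have "\<exists>B\<in>A. \<forall>P\<in>A. B \<subseteq> P \<longrightarrow> P = B"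
  proof (rule subset_Zorn')
    fix C
    assume C: "subset.chain A C"
    have "cinner H x y = of_bool (x = y)" if xy: "x \<in> \<Union>C" "y \<in> \<Union>C" for x y
    proof -
      obtain P Q where PQ: "P \<in> C" "Q \<in> C" "x \<in> P" "y \<in> Q"
        using xy by blast
      then have "P \<subseteq> Q \<or> Q \<subseteq> P"
        using C by (auto simp: subset_chain_def)
      then obtain W where "W \<in> C" "x \<in> W" "y \<in> W"
        using PQ by blast
      then show ?thesis
        using C unfolding subset_chain_def A_def by blast
    qed
    moreover have "\<Union>C \<subseteq> carrier H"
      using C unfolding subset_chain_def A_def by blast
    ultimately show "\<Union>C \<in> A"
      by (simp add: A_def)
  qed
  then obtain B where B: "B \<in> A" and max: "\<And>P. P \<in> A \<Longrightarrow> B \<subseteq> P \<Longrightarrow> P = B"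
    by blast
  have "z = \<zero>" if z: "z \<in> carrier H" and orth: "\<forall>b\<in>B. cinner H z b = 0" for z
  proof (rule ccontr)
    assume "z \<noteq> \<zero>"
    then have n: "hnorm H z \<noteq> 0"
      using z hnorm_eq_0_iff by blast
    define u where "u = of_real (inverse (hnorm H z)) \<odot> z"
    have u: "u \<in> carrier H"
      using z by (simp add: u_def)
    have "hnorm H u = 1"
      using z n by (simp add: u_def hnorm_smult norm_inverse)
    then have uu: "cinner H u u = 1"
      using cinner_self[OF u] by simp
    have ub: "cinner H u b = 0 \<and> cinner H b u = 0" if "b \<in> B" for b
      using that orth z B cinner_commute[of u b] u by (auto simp: u_def cinner_linear A_def subset_iff)
    then have "u \<notin> B"
      using uu by force
    moreover have "insert u B \<in> A"
      using B u uu ub \<open>u \<notin> B\<close> by (auto simp: A_def)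
    ultimately show False
      using max[of "insert u B"] by blast
  qed
  moreover have "B \<subseteq> carrier H" "\<forall>x\<in>B. \<forall>y\<in>B. cinner H x y = of_bool (x = y)"
    using B by (simp_all add: A_def)
  ultimately show ?thesis
    by (intro exI[of _ B] conjI ballI impI) simp_all
qed

text \<open>A maximal orthonormal set is infinite because a finite one would span the space, and it is
  countable because its members are far from each other whereas a countable set comes close to each of
  them. Hence it can be indexed by the natural numbers.\<close>

lemma exists_orthonormal_basis:
  assumes sep: "separable_space (htopology H)" and inf: "infinite_dimensional H"
  shows "\<exists>e. orthonormal_basis H e"
proof -
  obtain B where B: "B \<subseteq> carrier H" "\<And>x y. x \<in> B \<Longrightarrow> y \<in> B \<Longrightarrow> cinner H x y = of_bool (x = y)"
    "\<And>z. z \<in> carrier H \<Longrightarrow> (\<forall>b\<in>B. cinner H z b = 0) \<Longrightarrow> z = \<zero>"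
    using exists_maximal_orthonormal_set by metis
  have "infinite B"
  proof
    assume fin: "finite B"
    have sub: "x \<in> S" if S: "submodule S complex_ring H" "B \<subseteq> S" and x: "x \<in> carrier H" for S x
    proof -
      let ?p = "finsum H (\<lambda>b. cinner H x b \<odot> b) B"
      have p: "?p \<in> carrier H"
        using B(1) by (auto intro!: finsum_closed)
      have "cinner H (x \<ominus> ?p) b = 0" if b: "b \<in> B" for b
      proof -
        have "cinner H ?p b = (\<Sum>a\<in>B. cinner H x a * of_bool (a = b))"
          using B(1,2) b fin
          by (subst cinner_finsum) (auto simp: cinner_smult subset_iff intro!: sum.cong)
        then show ?thesis
          using x p b B(1) fin by (auto simp: cinner_diff subset_iff of_bool_def if_distrib
              sum.delta cong: if_cong)
      qed
      then have "x = ?p"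
        using B(3)[of "x \<ominus> ?p"] x p by (simp add: minus_eq_zero_iff)
      moreover have "finsum H (\<lambda>b. cinner H x b \<odot> b) F \<in> S" if "F \<subseteq> B" "finite F" for F
        using that(2,1)
      proof (induction F rule: finite_induct)
        case empty
        then show ?case
          using subgroup.one_closed[OF submodule.axioms(1)[OF S(1)]] by simp
      next
        case (insert b F)
        then show ?case
          using B(1) S submoduleE(4)[OF S(1), of "cinner H x b" b] submoduleE(5)[OF S(1)]
          by (subst finsum_insert) (auto simp: ring_of_type_algebra_def subset_iff)
      qed
      then have "?p \<in> S"
        using fin by blast
      ultimately show ?thesis
        by simp
    qed
    have "(\<lambda>S. submodule S complex_ring H) hull B = carrier H"
      using sub carrier_is_submodule B(1) unfolding hull_def by blast
    then show False
      using inf fin B(1) unfolding infinite_dimensional_def by blast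
  qed
  moreover have "countable B"
  proof -
    obtain D where D: "range D \<subseteq> carrier H"
      "\<And>x e. x \<in> carrier H \<Longrightarrow> e > 0 \<Longrightarrow> \<exists>n::nat. hnorm H (x \<ominus> D n) < e"
      using exists_dense_sequence[OF sep] by blast
    have "\<exists>n. hnorm H (b \<ominus> D n) < 1 / 2" if "b \<in> B" for b
      using that B(1) by (intro D(2)) auto
    then obtain f where f: "\<And>b. b \<in> B \<Longrightarrow> hnorm H (b \<ominus> D (f b)) < 1 / 2"
      by metis
    \<comment> \<open>Distinct members of \<open>B\<close> have distance \<open>\<surd>2\<close>, so no point is within \<open>1/2\<close> of both.\<close>
    have "inj_on f B"
    proof (rule inj_onI, rule ccontr)
      fix a b
      assume ab: "a \<in> B" "b \<in> B" "f a = f b" "a \<noteq> b"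
      then have car: "a \<in> carrier H" "b \<in> carrier H" "D (f b) \<in> carrier H"
        using B(1) D(1) by auto
      have "(hnorm H (a \<ominus> b))\<^sup>2 = 2"
        using ab car B(2) by (simp add: hnorm_sq cinner_linear)
      moreover have "hnorm H (a \<ominus> b) < 1"
        using hnorm_diff_triangle[of a "D (f b)" b] f[OF ab(1)] f[OF ab(2)] ab(3) car
          hnorm_minus_commute[of b "D (f b)"] by simp
      ultimately show False
        using power_mono[of "hnorm H (a \<ominus> b)" 1 2] car by simp
    qed
    then show ?thesis
      by (rule countableI')
  qed
  ultimately have "bij_betw (from_nat_into B) UNIV B"
    by (intro bij_betw_from_nat_into)
  then obtain e :: "nat \<Rightarrow> 'a" where e: "inj e" "range e = B"
    unfolding bij_betw_def by blast
  have "orthonormal H e"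
    unfolding orthonormal_def using B(1,2) e by (auto simp: inj_eq)
  moreover have "z = \<zero>" if "z \<in> carrier H" "\<forall>n. cinner H z (e n) = 0" for z
    using that e(2) by (intro B(3)) auto
  ultimately show ?thesis
    unfolding orthonormal_basis_def by blast
qed

end

lemma exists_with_same_coefficients:
  assumes H: "hilbert_space H" and K: "hilbert_space K"
    and e: "orthonormal_basis H e" and f: "orthonormal_basis K f" and x: "x \<in> carrier H"
  shows "\<exists>y\<in>carrier K. \<forall>n. cinner K y (f n) = cinner H x (e n)"
proof -
  interpret H: hilbert_space H by fact
  interpret K: hilbert_space K by fact
  have "orthonormal H e" "orthonormal K f"
    using e f by (auto simp: orthonormal_basis_def)
  then have "\<exists>y. hlimit K (partial_sum K f (\<lambda>n. cinner H x (e n))) y \<and>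
      (\<forall>n. cinner K y (f n) = cinner H x (e n))"
    by (intro K.Riesz_Fischer[where B = "(hnorm H x)\<^sup>2"] H.Bessel x)
  then obtain y where "hlimit K (partial_sum K f (\<lambda>n. cinner H x (e n))) y"
    "\<forall>n. cinner K y (f n) = cinner H x (e n)"
    by (elim exE conjE)
  then show ?thesis
    by (intro bexI[of _ y] K.hlimit_in_carrier(2))
qed

text \<open>The unitary is the map that keeps the coefficients. They determine a vector and can be
  transported between the bases in both directions, which gives linearity and surjectivity; Parseval's
  identity gives the inner products.\<close>

lemma exists_unitary_from_bases:
  assumes "hilbert_space H" "hilbert_space K"
    and e: "orthonormal_basis H e" and f: "orthonormal_basis K f"
  shows "\<exists>U. unitary_op H K U"
proof -
  interpret H: hilbert_space H by fact
  interpret K: hilbert_space K by fact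
  define U where "U = (\<lambda>x\<in>carrier H. SOME y. y \<in> carrier K \<and>
    (\<forall>n. cinner K y (f n) = cinner H x (e n)))"
  have U: "U x \<in> carrier K \<and> (\<forall>n. cinner K (U x) (f n) = cinner H x (e n))"
    if x: "x \<in> carrier H" for x
    unfolding U_def using someI_ex[of "\<lambda>y. y \<in> carrier K \<and> (\<forall>n. cinner K y (f n) = cinner H x (e n))"]
      exists_with_same_coefficients[OF assms(1,2) e f x] x by auto
  have U_eqI: "U x = y"
    if "x \<in> carrier H" "y \<in> carrier K" "\<And>n. cinner K y (f n) = cinner H x (e n)" for x y
    using K.orthonormal_basis_eqI[OF f, of "U x" y] that U by simp
  have basis [simp]: "e n \<in> carrier H" "f n \<in> carrier K" for n
    using e f by (auto simp: orthonormal_basis_def orthonormal_def)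
  have "unitary_op H K U"
    unfolding unitary_op_def linear_op_def
  proof (intro conjI ballI allI)
    show "U \<in> carrier H \<rightarrow>\<^sub>E carrier K"
      using U by (auto simp: U_def)
    show "U (x \<oplus>\<^bsub>H\<^esub> y) = U x \<oplus>\<^bsub>K\<^esub> U y" if "x \<in> carrier H" "y \<in> carrier H" for x y
      by (rule U_eqI) (use that U in \<open>simp_all add: H.cinner_add K.cinner_add\<close>)
    show "U (c \<odot>\<^bsub>H\<^esub> x) = c \<odot>\<^bsub>K\<^esub> U x" if "x \<in> carrier H" for c x
      by (rule U_eqI) (use that U in \<open>simp_all add: H.cinner_smult K.cinner_smult\<close>)
    show "U ` carrier H = carrier K"
    proof
      show "carrier K \<subseteq> U ` carrier H"
      proof
        fix y
        assume y: "y \<in> carrier K"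
        then obtain x where "x \<in> carrier H" "\<forall>n. cinner H x (e n) = cinner K y (f n)"
          using exists_with_same_coefficients[OF assms(2,1) f e] by blast
        then have "U x = y"
          using y by (intro U_eqI) auto
        then show "y \<in> U ` carrier H"
          using \<open>x \<in> carrier H\<close> by blast
      qed
    qed (use U in auto)
    show "cinner K (U x) (U y) = cinner H x y" if "x \<in> carrier H" "y \<in> carrier H" for x y
      using K.Parseval[OF f, of "U x" "U y"] H.Parseval[OF e, of x y] U[of x] U[of y] that
      by (auto intro: sums_unique2)
  qed
  then show ?thesis
    by blast
qed

lemma exists_unitary:
  assumes "separable_inf_dim_hilbert H" "separable_inf_dim_hilbert K"
  shows "\<exists>U. unitary_op H K U"
proof -
  obtain e f where "orthonormal_basis H e" "orthonormal_basis K f"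
    using assms hilbert_space.exists_orthonormal_basis
    unfolding separable_inf_dim_hilbert_def by blast
  then show ?thesis
    using assms exists_unitary_from_bases by (auto simp: separable_inf_dim_hilbert_def)
qed

section \<open>Linear and unitary operators\<close>

lemma linear_op_in_carrier: "linear_op H K T \<Longrightarrow> x \<in> carrier H \<Longrightarrow> T x \<in> carrier K"
  by (auto simp: linear_op_def)

lemma linear_op_extensional: "linear_op H K T \<Longrightarrow> T \<in> extensional (carrier H)"
  by (simp add: linear_op_def PiE_def)

lemma linear_op_smult:
  "linear_op H K T \<Longrightarrow> x \<in> carrier H \<Longrightarrow> T (c \<odot>\<^bsub>H\<^esub> x) = c \<odot>\<^bsub>K\<^esub> T x"
  by (auto simp: linear_op_def)

lemma linear_op_add:
  "linear_op H K T \<Longrightarrow> x \<in> carrier H \<Longrightarrow> y \<in> carrier H \<Longrightarrow> T (x \<oplus>\<^bsub>H\<^esub> y) = T x \<oplus>\<^bsub>K\<^esub> T y"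
  by (auto simp: linear_op_def)

lemma linear_op_diff:
  assumes "hilbert_space H" "hilbert_space K" "linear_op H K T" "x \<in> carrier H" "y \<in> carrier H"
  shows "T (x \<ominus>\<^bsub>H\<^esub> y) = T x \<ominus>\<^bsub>K\<^esub> T y"
proof -
  interpret H: hilbert_space H by fact
  interpret K: hilbert_space K by fact
  show ?thesis
    using assms(3-) linear_op_in_carrier[OF assms(3)]
    by (simp add: H.minus_eq_add_smult K.minus_eq_add_smult linear_op_add[OF assms(3)]
        linear_op_smult[OF assms(3)])
qed

lemma unitary_op_linear: "unitary_op H K U \<Longrightarrow> linear_op H K U"
  by (simp add: unitary_op_def)

lemma unitary_op_in_carrier: "unitary_op H K U \<Longrightarrow> x \<in> carrier H \<Longrightarrow> U x \<in> carrier K"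
  by (rule linear_op_in_carrier[OF unitary_op_linear])

lemma unitary_op_hnorm: "unitary_op H K U \<Longrightarrow> x \<in> carrier H \<Longrightarrow> hnorm K (U x) = hnorm H x"
  by (simp add: unitary_op_def hnorm_def)

lemma unitary_op_hnorm_diff:
  assumes "hilbert_space H" "hilbert_space K" "unitary_op H K U" "x \<in> carrier H" "y \<in> carrier H"
  shows "hnorm K (U x \<ominus>\<^bsub>K\<^esub> U y) = hnorm H (x \<ominus>\<^bsub>H\<^esub> y)"
proof -
  interpret H: hilbert_space H by fact
  show ?thesis
    using linear_op_diff[OF assms(1,2) unitary_op_linear[OF assms(3)] assms(4,5)]
      unitary_op_hnorm[OF assms(3), of "x \<ominus>\<^bsub>H\<^esub> y"] assms(4,5) by simp
qed

lemma unitary_op_inj_on: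
  assumes "hilbert_space H" "hilbert_space K" "unitary_op H K U"
  shows "inj_on U (carrier H)"
proof (rule inj_onI)
  interpret H: hilbert_space H by fact
  interpret K: hilbert_space K by fact
  fix x y
  assume xy: "x \<in> carrier H" "y \<in> carrier H" "U x = U y"
  then have "hnorm H (x \<ominus>\<^bsub>H\<^esub> y) = 0"
    using unitary_op_hnorm_diff[OF assms xy(1,2)] unitary_op_in_carrier[OF assms(3)]
    by (simp add: K.minus_eq_zero_iff[THEN iffD2])
  then show "x = y"
    using xy H.hnorm_eq_0_iff[of "x \<ominus>\<^bsub>H\<^esub> y"] by (simp add: H.minus_eq_zero_iff)
qed

lemma unitary_op_id:
  "unitary_op H H (\<lambda>x\<in>carrier H. x)" if "hilbert_space H"
proof -
  interpret hilbert_space H by fact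
  show ?thesis
    by (auto simp: unitary_op_def linear_op_def)
qed

lemma unitary_op_compose:
  assumes "hilbert_space H" "unitary_op H K U" "unitary_op K L V"
  shows "unitary_op H L (compose (carrier H) V U)"
proof -
  interpret hilbert_space H by fact
  have "compose (carrier H) V U ` carrier H = carrier L"
    using assms unfolding unitary_op_def by (metis surj_compose)
  moreover have "compose (carrier H) V U \<in> carrier H \<rightarrow>\<^sub>E carrier L"
    using assms by (auto simp: compose_def unitary_op_in_carrier)
  ultimately show ?thesis
    using assms unitary_op_in_carrier[OF assms(2)] unfolding unitary_op_def linear_op_def
    by (simp add: compose_eq)
qed

lemma unitary_op_bounded: "unitary_op H K U \<Longrightarrow> bounded_op H K U"
  unfolding bounded_op_def by (intro conjI exI[of _ 1]) (auto simp: unitary_op_linear unitary_op_hnorm)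

text \<open>The inverse of \<open>U\<close> has the defining property of the adjoint. This property determines the
  values on the carrier, and extensionality those outside of it, so the definite description denotes
  the inverse.\<close>

lemma adjoint_unitary_op:
  assumes H: "hilbert_space H" and K: "hilbert_space K" and U: "unitary_op H K U"
  shows unitary_op_adjoint: "unitary_op K H (adjoint_op H K U)"
    and unitary_adjoint_left: "x \<in> carrier H \<Longrightarrow> adjoint_op H K U (U x) = x"
    and unitary_adjoint_right: "y \<in> carrier K \<Longrightarrow> U (adjoint_op H K U y) = y"
proof -
  interpret H: hilbert_space H by fact
  interpret K: hilbert_space K by fact
  define V where "V = (\<lambda>y\<in>carrier K. inv_into (carrier H) U y)"
  have img: "U ` carrier H = carrier K"
    using U by (simp add: unitary_op_def)
  have V_car: "V y \<in> carrier H" if "y \<in> carrier K" for y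
    using that img by (auto simp: V_def intro: inv_into_into)
  have UV: "U (V y) = y" if "y \<in> carrier K" for y
    using that img by (auto simp: V_def intro: f_inv_into_f)
  have VU: "V (U x) = x" if "x \<in> carrier H" for x
    using that unitary_op_inj_on[OF H K U] unitary_op_in_carrier[OF U] by (simp add: V_def)
  have V_eqI: "V y = x" if "x \<in> carrier H" "U x = y" for x y
    using VU that by blast
  have V: "unitary_op K H V"
    unfolding unitary_op_def linear_op_def
  proof (intro conjI ballI allI)
    show "V \<in> carrier K \<rightarrow>\<^sub>E carrier H"
      using V_car by (auto simp: V_def)
    show "V (x \<oplus>\<^bsub>K\<^esub> y) = V x \<oplus>\<^bsub>H\<^esub> V y" if "x \<in> carrier K" "y \<in> carrier K" for x y
      using that U by (intro V_eqI) (simp_all add: V_car UV linear_op_add[OF unitary_op_linear])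
    show "V (c \<odot>\<^bsub>K\<^esub> x) = c \<odot>\<^bsub>H\<^esub> V x" if "x \<in> carrier K" for c x
      using that U by (intro V_eqI) (simp_all add: V_car UV linear_op_smult[OF unitary_op_linear])
    show "V ` carrier K = carrier H"
      using V_car VU unitary_op_in_carrier[OF U] by (force simp: image_iff)
    show "cinner H (V x) (V y) = cinner K x y" if "x \<in> carrier K" "y \<in> carrier K" for x y
      using that U V_car UV unfolding unitary_op_def by metis
  qed
  have "is_adjoint H K U V"
    unfolding is_adjoint_def
  proof (intro conjI ballI)
    show "cinner K (U x) y = cinner H x (V y)" if "x \<in> carrier H" "y \<in> carrier K" for x y
      using that U V_car UV unfolding unitary_op_def by metis
  qed (simp_all add: U V unitary_op_bounded)
  moreover have "S = V" if S: "is_adjoint H K U S" for S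
  proof (rule extensionalityI[of _ "carrier K"])
    show "S \<in> extensional (carrier K)" "V \<in> extensional (carrier K)"
      using S linear_op_extensional[of K H S] by (simp_all add: is_adjoint_def bounded_op_def V_def)
    fix y
    assume y: "y \<in> carrier K"
    have Sy: "S y \<in> carrier H"
      using S y by (auto simp: is_adjoint_def bounded_op_def intro: linear_op_in_carrier)
    show "S y = V y"
    proof (rule H.eqI_cinner)
      fix z
      assume z: "z \<in> carrier H"
      have "cinner H z (S y) = cinner H z (V y)"
        using S \<open>is_adjoint H K U V\<close> y z unfolding is_adjoint_def by metis
      then show "cinner H (S y) z = cinner H (V y) z"
        using H.cinner_commute z Sy V_car[OF y] by metis
    qed (use Sy V_car y in auto)
  qed
  ultimately have "adjoint_op H K U = V"
    unfolding adjoint_op_def by (intro the_equality)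
  then show "unitary_op K H (adjoint_op H K U)"
    "x \<in> carrier H \<Longrightarrow> adjoint_op H K U (U x) = x"
    "y \<in> carrier K \<Longrightarrow> U (adjoint_op H K U y) = y"
    using V UV VU by simp_all
qed

lemma conj_op_apply:
  assumes "hilbert_space H" "hilbert_space K" "unitary_op H K U" "x \<in> carrier H"
  shows "conj_op H K U R (U x) = U (R x)"
  using assms by (simp add: conj_op_def compose_def unitary_op_in_carrier unitary_adjoint_left)

text \<open>Unitary equivalence is the intertwining relation \<open>S U = U R\<close>, a form in which no adjoint
  occurs.\<close>

lemma eq_conj_op_iff:
  assumes H: "hilbert_space H" and K: "hilbert_space K" and U: "unitary_op H K U"
    and S: "linear_op K K S"
  shows "S = conj_op H K U R \<longleftrightarrow> (\<forall>x\<in>carrier H. S (U x) = U (R x))"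
proof
  assume intertwining: "\<forall>x\<in>carrier H. S (U x) = U (R x)"
  show "S = conj_op H K U R"
  proof (rule extensionalityI[of _ "carrier K"])
    show "S \<in> extensional (carrier K)" "conj_op H K U R \<in> extensional (carrier K)"
      using linear_op_extensional[OF S] by (simp_all add: conj_op_def)
    fix y
    assume "y \<in> carrier K"
    then obtain x where "x \<in> carrier H" "y = U x"
      using U unfolding unitary_op_def by (metis imageE)
    then show "S y = conj_op H K U R y"
      using intertwining conj_op_apply[OF H K U] by simp
  qed
qed (use conj_op_apply[OF H K U] in simp)

lemma op_norm_bounds:
  assumes H: "hilbert_space H" and K: "hilbert_space K" and T: "bounded_op H K T"
  shows op_norm_nonneg: "0 \<le> op_norm H K T"
    and hnorm_le_op_norm: "x \<in> carrier H \<Longrightarrow> hnorm K (T x) \<le> op_norm H K T * hnorm H x"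
proof -
  interpret H: hilbert_space H by fact
  interpret K: hilbert_space K by fact
  have lin: "linear_op H K T"
    using T by (simp add: bounded_op_def)
  note [simp] = linear_op_in_carrier[OF lin]
  obtain C where C: "\<And>x. x \<in> carrier H \<Longrightarrow> hnorm K (T x) \<le> C * hnorm H x"
    using T unfolding bounded_op_def by blast
  have bdd: "bdd_above ((\<lambda>x. hnorm K (T x)) ` {x \<in> carrier H. hnorm H x \<le> 1})"
  proof (rule bdd_aboveI2)
    fix x
    assume x: "x \<in> {x \<in> carrier H. hnorm H x \<le> 1}"
    have "hnorm K (T x) \<le> C * hnorm H x"
      using x C by simp
    also have "\<dots> \<le> \<bar>C\<bar> * 1"
      using x by (intro mult_mono) auto
    finally show "hnorm K (T x) \<le> \<bar>C\<bar>"
      by simp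
  qed
  have upper: "hnorm K (T x) \<le> op_norm H K T" if "x \<in> carrier H" "hnorm H x \<le> 1" for x
    unfolding op_norm_def using bdd that by (intro cSUP_upper) auto
  show "0 \<le> op_norm H K T"
    using upper[of "\<zero>\<^bsub>H\<^esub>"] K.hnorm_nonneg[of "T \<zero>\<^bsub>H\<^esub>"] by (simp del: K.hnorm_nonneg)
  assume x: "x \<in> carrier H"
  show "hnorm K (T x) \<le> op_norm H K T * hnorm H x"
  proof (cases "hnorm H x = 0")
    case True
    then show ?thesis
      using C[OF x] x by simp
  next
    case False
    define c :: complex where "c = of_real (inverse (hnorm H x))"
    have c: "cmod c = inverse (hnorm H x)"
      using x H.hnorm_nonneg[OF x] by (simp add: c_def norm_inverse)
    have "hnorm K (T (c \<odot>\<^bsub>H\<^esub> x)) \<le> op_norm H K T"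
      using False x by (intro upper) (auto simp: H.hnorm_smult c)
    then have "inverse (hnorm H x) * hnorm K (T x) \<le> op_norm H K T"
      using x by (simp add: linear_op_smult[OF lin] K.hnorm_smult c)
    moreover have "hnorm H x > 0"
      using False H.hnorm_nonneg[OF x] by linarith
    ultimately show ?thesis
      by (simp add: field_simps)
  qed
qed

lemma op_norm_le:
  assumes H: "hilbert_space H" and C: "0 \<le> C"
    and le: "\<And>x. x \<in> carrier H \<Longrightarrow> hnorm K (T x) \<le> C * hnorm H x"
  shows "op_norm H K T \<le> C"
  unfolding op_norm_def
proof (rule cSUP_least)
  interpret H: hilbert_space H by fact
  show "{x \<in> carrier H. hnorm H x \<le> 1} \<noteq> {}"
    using H.zero_closed H.hnorm_zero by force
  fix x
  assume "x \<in> {x \<in> carrier H. hnorm H x \<le> 1}"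
  then show "hnorm K (T x) \<le> C"
    using le[of x] C mult_left_le[of "hnorm H x" C] by simp
qed

section \<open>The defect of a unitary operator\<close>

text \<open>The quantity whose infimum is the distance. Since \<open>U\<close> maps the unit ball onto the unit
  ball, it is also the operator norm of the commutator \<open>S U - U R\<close>. That form needs no adjoint, and
  all estimates are made in it.\<close>

definition defect ::
  "'a hilbert \<Rightarrow> 'a hilbert \<Rightarrow> ('a \<Rightarrow> 'a) \<Rightarrow> ('a \<Rightarrow> 'a) \<Rightarrow> ('a \<Rightarrow> 'a) \<Rightarrow> real" where
  "defect H K R S U = op_norm K K (op_diff K K S (conj_op H K U R))"

lemma bounded_op_diff_conj:
  assumes H: "hilbert_space H" and K: "hilbert_space K" and U: "unitary_op H K U"
    and R: "bounded_op H H R" and S: "bounded_op K K S"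
  shows "bounded_op K K (op_diff K K S (conj_op H K U R))"
proof -
  interpret H: hilbert_space H by fact
  interpret K: hilbert_space K by fact
  let ?V = "adjoint_op H K U"
  have V: "unitary_op K H ?V"
    by (rule unitary_op_adjoint[OF H K U])
  have lin: "linear_op K H ?V" "linear_op H H R" "linear_op H K U" "linear_op K K S"
    using V R U S by (auto simp: bounded_op_def unitary_op_linear)
  note car = lin[THEN linear_op_in_carrier]
  have eq: "op_diff K K S (conj_op H K U R) y = S y \<ominus>\<^bsub>K\<^esub> U (R (?V y))" if "y \<in> carrier K" for y
    using that by (simp add: op_diff_def conj_op_def compose_def)
  obtain C where C: "\<And>x. x \<in> carrier H \<Longrightarrow> hnorm H (R x) \<le> C * hnorm H x"
    using R unfolding bounded_op_def by blast
  obtain D where D: "\<And>x. x \<in> carrier K \<Longrightarrow> hnorm K (S x) \<le> D * hnorm K x"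
    using S unfolding bounded_op_def by blast
  have "hnorm K (S y \<ominus>\<^bsub>K\<^esub> U (R (?V y))) \<le> (D + C) * hnorm K y" if y: "y \<in> carrier K" for y
  proof -
    have "hnorm K (S y \<ominus>\<^bsub>K\<^esub> U (R (?V y))) \<le> hnorm K (S y) + hnorm K (U (R (?V y)))"
      using y car by (intro K.hnorm_diff_le) auto
    also have "hnorm K (U (R (?V y))) \<le> C * hnorm K y"
      using y car C[of "?V y"] by (simp add: unitary_op_hnorm[OF U] unitary_op_hnorm[OF V])
    finally show ?thesis
      using D[OF y] by (simp add: algebra_simps)
  qed
  moreover have "linear_op K K (op_diff K K S (conj_op H K U R))"
    unfolding linear_op_def
  proof (intro conjI ballI allI)
    show "op_diff K K S (conj_op H K U R) \<in> carrier K \<rightarrow>\<^sub>E carrier K"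
      using car eq by (auto simp: op_diff_def)
    fix x y c
    assume x: "x \<in> carrier K"
    show "op_diff K K S (conj_op H K U R) (c \<odot>\<^bsub>K\<^esub> x) =
        c \<odot>\<^bsub>K\<^esub> op_diff K K S (conj_op H K U R) x"
      using x car by (intro K.eqI_cinner)
        (auto simp: eq K.cinner_linear lin[THEN linear_op_smult] algebra_simps)
    assume y: "y \<in> carrier K"
    show "op_diff K K S (conj_op H K U R) (x \<oplus>\<^bsub>K\<^esub> y) =
        op_diff K K S (conj_op H K U R) x \<oplus>\<^bsub>K\<^esub> op_diff K K S (conj_op H K U R) y"
      using x y car by (intro K.eqI_cinner)
        (auto simp: eq K.cinner_linear lin[THEN linear_op_add] algebra_simps)
  qed
  ultimately show ?thesis
    unfolding bounded_op_def by (metis eq)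
qed

lemma
  assumes H: "hilbert_space H" and K: "hilbert_space K" and U: "unitary_op H K U"
    and R: "bounded_op H H R" and S: "bounded_op K K S"
  shows defect_nonneg: "0 \<le> defect H K R S U"
    and hnorm_commutator_le_defect:
      "x \<in> carrier H \<Longrightarrow> hnorm K (S (U x) \<ominus>\<^bsub>K\<^esub> U (R x)) \<le> defect H K R S U * hnorm H x"
    and defect_le:
      "\<lbrakk>0 \<le> C; \<And>x. x \<in> carrier H \<Longrightarrow> hnorm K (S (U x) \<ominus>\<^bsub>K\<^esub> U (R x)) \<le> C * hnorm H x\<rbrakk>
        \<Longrightarrow> defect H K R S U \<le> C"
proof -
  note bd = bounded_op_diff_conj[OF assms]
  have eq: "op_diff K K S (conj_op H K U R) (U x) = S (U x) \<ominus>\<^bsub>K\<^esub> U (R x)" if "x \<in> carrier H" for x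
    using that unitary_op_in_carrier[OF U] conj_op_apply[OF H K U] by (simp add: op_diff_def)
  show "0 \<le> defect H K R S U"
    unfolding defect_def by (rule op_norm_nonneg[OF K K bd])
  show "hnorm K (S (U x) \<ominus>\<^bsub>K\<^esub> U (R x)) \<le> defect H K R S U * hnorm H x" if "x \<in> carrier H"
    using hnorm_le_op_norm[OF K K bd, of "U x"] that
    by (simp add: defect_def eq unitary_op_hnorm[OF U] unitary_op_in_carrier[OF U])
  assume C: "0 \<le> C"
    and le: "\<And>x. x \<in> carrier H \<Longrightarrow> hnorm K (S (U x) \<ominus>\<^bsub>K\<^esub> U (R x)) \<le> C * hnorm H x"
  show "defect H K R S U \<le> C"
    unfolding defect_def
  proof (rule op_norm_le[OF K C])
    fix y
    assume "y \<in> carrier K"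
    then obtain x where "x \<in> carrier H" "y = U x"
      using U unfolding unitary_op_def by (metis imageE)
    then show "hnorm K (op_diff K K S (conj_op H K U R) y) \<le> C * hnorm K y"
      using le by (simp add: eq unitary_op_hnorm[OF U])
  qed
qed

text \<open>Unitaries preserve the norm, so replacing \<open>U\<close> by its inverse only rearranges the
  commutator: \<open>R U\<^sup>* y - U\<^sup>* S y = - U\<^sup>* (S U x - U R x)\<close> with \<open>x = U\<^sup>* y\<close>.\<close>

lemma defect_adjoint_le:
  assumes H: "hilbert_space H" and K: "hilbert_space K" and U: "unitary_op H K U"
    and R: "bounded_op H H R" and S: "bounded_op K K S"
  shows "defect K H S R (adjoint_op H K U) \<le> defect H K R S U"
proof (rule defect_le[OF K H unitary_op_adjoint[OF H K U] S R])
  interpret K: hilbert_space K by fact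
  note U' = unitary_op_adjoint[OF H K U]
  note car [simp] = unitary_op_in_carrier[OF U] unitary_op_in_carrier[OF U']
  have lin: "linear_op H H R" "linear_op K K S"
    using R S by (simp_all add: bounded_op_def)
  note [simp] = lin[THEN linear_op_in_carrier]
  show "0 \<le> defect H K R S U"
    by (rule defect_nonneg[OF assms])
  fix y
  assume y: "y \<in> carrier K"
  let ?x = "adjoint_op H K U y"
  have "hnorm H (R ?x \<ominus>\<^bsub>H\<^esub> adjoint_op H K U (S y)) =
      hnorm K (U (R ?x) \<ominus>\<^bsub>K\<^esub> U (adjoint_op H K U (S y)))"
    using y by (intro unitary_op_hnorm_diff[OF H K U, symmetric]) auto
  also have "\<dots> = hnorm K (S (U ?x) \<ominus>\<^bsub>K\<^esub> U (R ?x))"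
    using y K.hnorm_minus_commute[of "U (R ?x)" "S y"]
    by (simp add: unitary_adjoint_right[OF H K U])
  also have "\<dots> \<le> defect H K R S U * hnorm K y"
    using hnorm_commutator_le_defect[OF assms, of ?x] y by (simp add: unitary_op_hnorm[OF U'])
  finally show "hnorm H (R ?x \<ominus>\<^bsub>H\<^esub> adjoint_op H K U (S y)) \<le> defect H K R S U * hnorm K y" .
qed

text \<open>Here \<open>T V U - V U R = (T V - V S) U + V (S U - U R)\<close>.\<close>

lemma defect_compose_le:
  assumes H: "hilbert_space H" and K: "hilbert_space K" and L: "hilbert_space L"
    and U: "unitary_op H K U" and V: "unitary_op K L V"
    and R: "bounded_op H H R" and S: "bounded_op K K S" and T: "bounded_op L L T"
  shows "defect H L R T (compose (carrier H) V U) \<le> defect H K R S U + defect K L S T V"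
proof (rule defect_le[OF H L unitary_op_compose[OF H U V] R T])
  interpret L: hilbert_space L by fact
  note [simp] = unitary_op_in_carrier[OF U] unitary_op_in_carrier[OF V]
  have lin: "linear_op H H R" "linear_op K K S" "linear_op L L T"
    using R S T by (simp_all add: bounded_op_def)
  note [simp] = lin[THEN linear_op_in_carrier]
  show "0 \<le> defect H K R S U + defect K L S T V"
    using defect_nonneg[OF H K U R S] defect_nonneg[OF K L V S T] by simp
  fix x
  assume x: "x \<in> carrier H"
  have "hnorm L (T (V (U x)) \<ominus>\<^bsub>L\<^esub> V (U (R x))) \<le>
      hnorm L (T (V (U x)) \<ominus>\<^bsub>L\<^esub> V (S (U x))) + hnorm L (V (S (U x)) \<ominus>\<^bsub>L\<^esub> V (U (R x)))"
    using x by (intro L.hnorm_diff_triangle) auto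
  also have "hnorm L (V (S (U x)) \<ominus>\<^bsub>L\<^esub> V (U (R x))) = hnorm K (S (U x) \<ominus>\<^bsub>K\<^esub> U (R x))"
    using x by (intro unitary_op_hnorm_diff[OF K L V]) auto
  also have "\<dots> \<le> defect H K R S U * hnorm H x"
    by (rule hnorm_commutator_le_defect[OF H K U R S x])
  also have "hnorm L (T (V (U x)) \<ominus>\<^bsub>L\<^esub> V (S (U x))) \<le> defect K L S T V * hnorm H x"
    using hnorm_commutator_le_defect[OF K L V S T, of "U x"] x by (simp add: unitary_op_hnorm[OF U])
  finally show "hnorm L (T (compose (carrier H) V U x) \<ominus>\<^bsub>L\<^esub> compose (carrier H) V U (R x)) \<le>
      (defect H K R S U + defect K L S T V) * hnorm H x"
    using x by (simp add: compose_eq algebra_simps)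
qed

lemma commutator_tendsto_zero:
  assumes H: "hilbert_space H" and K: "hilbert_space K" and U: "\<And>n::nat. unitary_op H K (U n)"
    and R: "bounded_op H H R" and S: "bounded_op K K S"
    and lim: "(\<lambda>n. defect H K R S (U n)) \<longlonglongrightarrow> 0" and x: "x \<in> carrier H"
  shows "(\<lambda>n. hnorm K (S (U n x) \<ominus>\<^bsub>K\<^esub> U n (R x))) \<longlonglongrightarrow> 0"
proof (rule Lim_null_comparison)
  interpret K: hilbert_space K by fact
  have lin: "linear_op H H R" "linear_op K K S"
    using R S by (simp_all add: bounded_op_def)
  show "(\<lambda>n. defect H K R S (U n) * hnorm H x) \<longlonglongrightarrow> 0"
    using lim by (rule tendsto_mult_left_zero)
  show "\<forall>\<^sub>F n in sequentially. norm (hnorm K (S (U n x) \<ominus>\<^bsub>K\<^esub> U n (R x))) \<le>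
      defect H K R S (U n) * hnorm H x"
    using hnorm_commutator_le_defect[OF H K U R S x] x unitary_op_in_carrier[OF U]
      lin[THEN linear_op_in_carrier] by simp
qed

section \<open>Strong convergence of almost intertwining unitaries\<close>

lemma bounded_op_hlimit:
  assumes H: "hilbert_space H" and K: "hilbert_space K" and T: "bounded_op H K T"
    and s: "hlimit H s l"
  shows "hlimit K (\<lambda>n. T (s n)) (T l)"
proof -
  interpret H: hilbert_space H by fact
  interpret K: hilbert_space K by fact
  have lin: "linear_op H K T"
    using T by (simp add: bounded_op_def)
  note car = H.hlimit_in_carrier[OF s]
  obtain C where C: "\<And>x. x \<in> carrier H \<Longrightarrow> hnorm K (T x) \<le> C * hnorm H x"
    using T unfolding bounded_op_def by blast
  show ?thesis
  proof (rule K.hlimitI)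
    show "hnorm K (T (s n) \<ominus>\<^bsub>K\<^esub> T l) \<le> C * hnorm H (s n \<ominus>\<^bsub>H\<^esub> l)" for n
      using C[of "s n \<ominus>\<^bsub>H\<^esub> l"] car by (simp add: linear_op_diff[OF H K lin])
    show "(\<lambda>n. C * hnorm H (s n \<ominus>\<^bsub>H\<^esub> l)) \<longlonglongrightarrow> 0"
      using s by (auto simp: hlimit_def intro: tendsto_mult_right_zero)
  qed (use car linear_op_in_carrier[OF lin] in auto)
qed

text \<open>Compactness speaks of the unit ball only, so the sequence is scaled into the ball and the
  limit is scaled back.\<close>

lemma compact_op_Cauchy_subseq:
  fixes s :: "nat \<Rightarrow> 'a"
  assumes H: "hilbert_space H" and K: "hilbert_space K" and T: "compact_op H K T"
    and s: "\<And>n. s n \<in> carrier H" and bound: "\<And>n. hnorm H (s n) \<le> B"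
  shows "\<exists>r::nat \<Rightarrow> nat. strict_mono r \<and> hCauchy K (\<lambda>n. T (s (r n)))"
proof -
  interpret H: hilbert_space H by fact
  interpret K: hilbert_space K by fact
  have lin: "linear_op H K T"
    using T by (simp add: compact_op_def bounded_op_def)
  note car = linear_op_in_carrier[OF lin]
  define b where "b = max B 1"
  have b: "b > 0" "B \<le> b"
    by (auto simp: b_def)
  define s' where "s' n = of_real (inverse b) \<odot>\<^bsub>H\<^esub> s n" for n
  have norm_s': "hnorm H (s' n) = inverse b * hnorm H (s n)" for n
    using s[of n] b unfolding s'_def H.hnorm_smult[OF s] norm_of_real by simp
  have s': "s' n \<in> carrier H" "hnorm H (s' n) \<le> 1" for n
  proof -
    show "s' n \<in> carrier H"
      using s by (simp add: s'_def)
    show "hnorm H (s' n) \<le> 1"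
      unfolding norm_s' using order_trans[OF bound[of n] b(2)] b(1) by (simp add: field_simps)
  qed
  define I where "I = T ` {x \<in> carrier H. hnorm H x \<le> 1}"
  have "I \<subseteq> htopology K closure_of I"
    using car by (intro closure_of_subset) (auto simp: I_def)
  then have "range (\<lambda>n. T (s' n)) \<subseteq> htopology K closure_of I"
    using s' by (auto simp: I_def)
  moreover have "\<forall>\<sigma>::nat \<Rightarrow> 'a. range \<sigma> \<subseteq> htopology K closure_of I \<longrightarrow>
      (\<exists>l r. l \<in> htopology K closure_of I \<and> strict_mono r \<and>
        limitin (htopology K) (\<sigma> \<circ> r) l sequentially)"
    using T unfolding compact_op_def K.hmet.compactin_sequentially I_def by (elim conjE)
  ultimately obtain l r where r: "strict_mono r"
    and l: "limitin (htopology K) ((\<lambda>n. T (s' n)) \<circ> r) l sequentially"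
    by blast
  have "hlimit K ((\<lambda>n. T (s' n)) \<circ> r) l"
    using l s' car by (auto simp: K.hlimit_iff_limitin)
  then have "hlimit K (\<lambda>n. of_real b \<odot>\<^bsub>K\<^esub> ((\<lambda>n. T (s' n)) \<circ> r) n) (of_real b \<odot>\<^bsub>K\<^esub> l)"
    by (rule K.hlimit_smult)
  moreover have "of_real b \<odot>\<^bsub>K\<^esub> T (s' n) = T (s n)" for n
  proof -
    have "of_real b \<odot>\<^bsub>H\<^esub> s' n = s n"
      using b s s' by (intro H.eqI_cinner) (auto simp: s'_def H.cinner_linear simp flip: of_real_inverse of_real_mult)
    then show ?thesis
      using linear_op_smult[OF lin s'(1)] by metis
  qed
  ultimately have "hlimit K (\<lambda>n. T (s (r n))) (of_real b \<odot>\<^bsub>K\<^esub> l)"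
    by simp
  then show ?thesis
    using r K.hlimit_imp_hCauchy by blast
qed

text \<open>If \<open>z\<close> is orthogonal to the range of \<open>R\<close>, then \<open>R z = 0\<close> by self-adjointness and
  \<open>z = 0\<close> by injectivity.\<close>

lemma (in hilbert_space) dense_range_self_adjoint:
  assumes R: "self_adjoint H R" "inj_on R (carrier H)"
    and x: "x \<in> carrier H" and e: "e > 0"
  shows "\<exists>w\<in>carrier H. hnorm H (x \<ominus> R w) < e"
proof -
  have lin: "linear_op H H R"
    using R by (simp add: self_adjoint_def is_adjoint_def bounded_op_def)
  note car = linear_op_in_carrier[OF lin]
  have zero: "R \<zero> = \<zero>"
    using linear_op_smult[OF lin zero_closed, of 0] car[of \<zero>] by (simp add: zero_smult)
  have neg: "\<ominus> y = (- 1) \<odot> y" if "y \<in> carrier H" for y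
    using that minus_eq_add_smult[of \<zero> y] by (simp add: a_minus_def)
  have "submodule (R ` carrier H) complex_ring H"
  proof (rule submoduleI)
    show "\<zero> \<in> R ` carrier H"
      using zero zero_closed by (metis imageI)
  qed (use car in \<open>auto simp: neg linear_op_smult[OF lin, symmetric] linear_op_add[OF lin, symmetric]\<close>)
  moreover have "z = \<zero>" if z: "z \<in> carrier H" and orth: "\<forall>s\<in>R ` carrier H. cinner H z s = 0" for z
  proof -
    have "cinner H (R z) y = cinner H z (R y)" if "y \<in> carrier H" for y
      using R(1) z that by (simp add: self_adjoint_def is_adjoint_def)
    then have "R z = \<zero>"
      using orth car z by (intro eqI_cinner) auto
    then show ?thesis
      using R(2) z zero zero_closed by (metis inj_onD)
  qed
  ultimately show ?thesis
    using exists_near_in_subspace[of "R ` carrier H" x e] x e by blast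
qed

text \<open>For each member \<open>D i\<close> of a dense sequence, compactness of \<open>S\<close> makes \<open>S (U n (D i))\<close>
  converge along a subsequence, and with it \<open>U n (R (D i))\<close>, because their difference tends to zero. A
  diagonal subsequence works for all \<open>i\<close>. The vectors \<open>R (D i)\<close> are dense, since the range of \<open>R\<close>
  is dense and \<open>R\<close> is continuous, and convergence of isometries on a dense set spreads to all
  vectors.\<close>

lemma almost_intertwining_Cauchy_subseq:
  assumes H: "hilbert_space H" and K: "hilbert_space K" and sep: "separable_space (htopology H)"
    and R: "bounded_op H H R"
    and dense: "\<And>x e. x \<in> carrier H \<Longrightarrow> e > 0 \<Longrightarrow> \<exists>w\<in>carrier H. hnorm H (x \<ominus>\<^bsub>H\<^esub> R w) < e"
    and S: "compact_op K K S" and U: "\<And>n::nat. unitary_op H K (U n)"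
    and lim: "\<And>x. x \<in> carrier H \<Longrightarrow> (\<lambda>n. hnorm K (S (U n x) \<ominus>\<^bsub>K\<^esub> U n (R x))) \<longlonglongrightarrow> 0"
  shows "\<exists>r. strict_mono r \<and> (\<forall>x\<in>carrier H. hCauchy K (\<lambda>n. U (r n) x))"
proof -
  interpret H: hilbert_space H by fact
  interpret K: hilbert_space K by fact
  have Rlin: "linear_op H H R"
    using R by (simp add: bounded_op_def)
  have Slin: "linear_op K K S"
    using S by (simp add: compact_op_def bounded_op_def)
  note car [simp] = linear_op_in_carrier[OF Rlin] linear_op_in_carrier[OF Slin]
    unitary_op_in_carrier[OF U]
  obtain D where D: "range D \<subseteq> carrier H"
    "\<And>x e. x \<in> carrier H \<Longrightarrow> e > 0 \<Longrightarrow> \<exists>i::nat. hnorm H (x \<ominus>\<^bsub>H\<^esub> D i) < e"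
    using H.exists_dense_sequence[OF sep] by blast
  have D_car [simp]: "D i \<in> carrier H" for i
    using D(1) by blast
  define P where "P i s = hCauchy K (\<lambda>n. U (s n) (R (D i)))" for i :: nat and s :: "nat \<Rightarrow> nat"
  interpret subseqs P
  proof
    fix i and s :: "nat \<Rightarrow> nat"
    assume s: "strict_mono s"
    obtain r where r: "strict_mono r" "hCauchy K (\<lambda>n. S (U (s (r n)) (D i)))"
      using compact_op_Cauchy_subseq[OF K K S, of "\<lambda>n. U (s n) (D i)" "hnorm H (D i)"]
      by (auto simp: unitary_op_hnorm[OF U])
    have "(\<lambda>n. hnorm K (S (U (s (r n)) (D i)) \<ominus>\<^bsub>K\<^esub> U (s (r n)) (R (D i)))) \<longlonglongrightarrow> 0"
      using LIMSEQ_subseq_LIMSEQ[OF lim[OF D_car[of i]] strict_mono_o[OF s r(1)]]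
      by (simp add: comp_def)
    then have "P i (s \<circ> r)"
      unfolding P_def comp_def by (intro K.hCauchy_perturb[OF r(2)]) auto
    then show "\<exists>r. strict_mono r \<and> P i (s \<circ> r)"
      using r(1) by blast
  qed
  define r where "r = diagseq"
  have r: "strict_mono r"
    unfolding r_def by (rule subseq_diagseq)
  have Cauchy_D: "hCauchy K (\<lambda>n. U (r n) (R (D i)))" for i
  proof (rule K.hCauchy_shift)
    \<comment> \<open>Only from the index \<open>i + 1\<close> on is the diagonal a subsequence of the one chosen for \<open>i\<close>.\<close>
    have "P i (diagseq \<circ> (+) (Suc i))"
      by (rule diagseq_holds)
        (auto simp: P_def comp_def dest: K.hCauchy_subseq)
    then show "hCauchy K ((\<lambda>n. U (r n) (R (D i))) \<circ> (+) (Suc i))"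
      by (simp add: P_def comp_def r_def)
  qed auto
  obtain C where C: "\<And>x. x \<in> carrier H \<Longrightarrow> hnorm H (R x) \<le> C * hnorm H x"
    using R unfolding bounded_op_def by blast
  have dense_D: "\<exists>i. hnorm H (x \<ominus>\<^bsub>H\<^esub> R (D i)) < e" if x: "x \<in> carrier H" and e: "e > 0" for x e
  proof -
    obtain w where w: "w \<in> carrier H" "hnorm H (x \<ominus>\<^bsub>H\<^esub> R w) < e / 2"
      using dense[OF x, of "e / 2"] e by auto
    obtain i where i: "hnorm H (w \<ominus>\<^bsub>H\<^esub> D i) < e / (2 * (\<bar>C\<bar> + 1))"
      using D(2)[OF w(1), of "e / (2 * (\<bar>C\<bar> + 1))"] e by auto
    have "hnorm H (R w \<ominus>\<^bsub>H\<^esub> R (D i)) \<le> C * hnorm H (w \<ominus>\<^bsub>H\<^esub> D i)"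
      using C[of "w \<ominus>\<^bsub>H\<^esub> D i"] w(1) by (simp add: linear_op_diff[OF H H Rlin])
    also have "\<dots> \<le> (\<bar>C\<bar> + 1) * hnorm H (w \<ominus>\<^bsub>H\<^esub> D i)"
      using w(1) by (intro mult_right_mono) auto
    also have "\<dots> < e / 2"
      using i by (simp add: field_simps)
    finally have "hnorm H (x \<ominus>\<^bsub>H\<^esub> R (D i)) < e"
      using H.hnorm_diff_triangle[of x "R w" "R (D i)"] x w by simp
    then show ?thesis ..
  qed
  have "hCauchy K (\<lambda>n. U (r n) x)" if x: "x \<in> carrier H" for x
    unfolding hCauchy_def
  proof (intro conjI allI impI)
    fix e :: real
    assume e: "e > 0"
    obtain i where i: "hnorm H (x \<ominus>\<^bsub>H\<^esub> R (D i)) < e / 3"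
      using dense_D[OF x, of "e / 3"] e by auto
    let ?y = "R (D i)"
    obtain N where N: "\<And>m n. m \<ge> N \<Longrightarrow> n \<ge> N \<Longrightarrow> hnorm K (U (r m) ?y \<ominus>\<^bsub>K\<^esub> U (r n) ?y) < e / 3"
      using K.hCauchyD[OF Cauchy_D[of i], of "e / 3"] e by auto
    have "hnorm K (U (r m) x \<ominus>\<^bsub>K\<^esub> U (r n) x) < e" if "m \<ge> N" "n \<ge> N" for m n
    proof -
      have near: "hnorm K (U k x \<ominus>\<^bsub>K\<^esub> U k ?y) < e / 3" for k
        using i unitary_op_hnorm_diff[OF H K U x] by simp
      have "hnorm K (U (r m) x \<ominus>\<^bsub>K\<^esub> U (r n) x) \<le>
          hnorm K (U (r m) x \<ominus>\<^bsub>K\<^esub> U (r m) ?y) + hnorm K (U (r m) ?y \<ominus>\<^bsub>K\<^esub> U (r n) x)"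
        using x by (intro K.hnorm_diff_triangle) auto
      also have "hnorm K (U (r m) ?y \<ominus>\<^bsub>K\<^esub> U (r n) x) \<le>
          hnorm K (U (r m) ?y \<ominus>\<^bsub>K\<^esub> U (r n) ?y) + hnorm K (U (r n) ?y \<ominus>\<^bsub>K\<^esub> U (r n) x)"
        using x by (intro K.hnorm_diff_triangle) auto
      also have "hnorm K (U (r n) ?y \<ominus>\<^bsub>K\<^esub> U (r n) x) = hnorm K (U (r n) x \<ominus>\<^bsub>K\<^esub> U (r n) ?y)"
        using x by (intro K.hnorm_minus_commute) auto
      finally show ?thesis
        using near[of "r m"] near[of "r n"] N[OF that] by linarith
    qed
    then show "\<exists>N. \<forall>m\<ge>N. \<forall>n\<ge>N. hnorm K (U (r m) x \<ominus>\<^bsub>K\<^esub> U (r n) x) < e"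
      by blast
  qed (use x in auto)
  then show ?thesis
    using r by blast
qed

lemma K01D:
  assumes "R \<in> K01 H"
  shows "compact_op H H R" "self_adjoint H R" "inj_on R (carrier H)" "bounded_op H H R"
    "linear_op H H R"
  using assms by (auto simp: K01_def compact_op_def bounded_op_def)

text \<open>A strong limit of unitaries is isometric, but it may fail to be surjective. Convergence of
  the adjoints repairs this: \<open>y\<close> is the image of the limit \<open>x\<close> of \<open>U\<^sub>n\<^sup>* y\<close>, since
  \<open>\<parallel>U\<^sub>n x - y\<parallel> = \<parallel>x - U\<^sub>n\<^sup>* y\<parallel>\<close>.\<close>

lemma strong_limit_unitary:
  assumes H: "hilbert_space H" and K: "hilbert_space K" and U: "\<And>n::nat. unitary_op H K (U n)"
    and CU: "\<And>x. x \<in> carrier H \<Longrightarrow> hCauchy K (\<lambda>n. U n x)"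
    and CV: "\<And>y. y \<in> carrier K \<Longrightarrow> hCauchy H (\<lambda>n. adjoint_op H K (U n) y)"
  shows "\<exists>V. unitary_op H K V \<and> (\<forall>x\<in>carrier H. hlimit K (\<lambda>n. U n x) (V x))"
proof -
  interpret H: hilbert_space H by fact
  interpret K: hilbert_space K by fact
  have "\<exists>V\<in>extensional (carrier H). \<forall>x\<in>carrier H. hlimit K (\<lambda>n. U n x) (V x)"
  proof -
    obtain V where "\<forall>x\<in>carrier H. hlimit K (\<lambda>n. U n x) (V x)"
      using K.hCauchy_imp_hlimit[OF CU] by metis
    then show ?thesis
      by (intro bexI[of _ "restrict V (carrier H)"]) auto
  qed
  then obtain V where V_ext: "V \<in> extensional (carrier H)"
    and V: "\<And>x. x \<in> carrier H \<Longrightarrow> hlimit K (\<lambda>n. U n x) (V x)"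
    by blast
  note V_car = K.hlimit_in_carrier(2)[OF V]
  note U_car = unitary_op_in_carrier[OF U]
  have "unitary_op H K V"
    unfolding unitary_op_def linear_op_def
  proof (intro conjI ballI allI)
    show "V \<in> carrier H \<rightarrow>\<^sub>E carrier K"
      using V_ext V_car by (auto simp: PiE_def)
    show "V (x \<oplus>\<^bsub>H\<^esub> y) = V x \<oplus>\<^bsub>K\<^esub> V y" if "x \<in> carrier H" "y \<in> carrier H" for x y
      using V[of "x \<oplus>\<^bsub>H\<^esub> y"] K.hlimit_add[OF V V, of x y] that
      by (simp add: linear_op_add[OF unitary_op_linear[OF U]] K.hlimit_unique)
    show "V (c \<odot>\<^bsub>H\<^esub> x) = c \<odot>\<^bsub>K\<^esub> V x" if "x \<in> carrier H" for c x
      using V[of "c \<odot>\<^bsub>H\<^esub> x"] K.hlimit_smult[OF V, of x c] that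
      by (simp add: linear_op_smult[OF unitary_op_linear[OF U]] K.hlimit_unique)
    show "cinner K (V x) (V y) = cinner H x y" if "x \<in> carrier H" "y \<in> carrier H" for x y
    proof -
      have "cinner K (U n x) (U n y) = cinner H x y" for n
        using U[of n] that by (simp add: unitary_op_def)
      then show ?thesis
        using K.hlimit_cinner[OF V[OF that(1)] V[OF that(2)]] by (simp add: LIMSEQ_const_iff)
    qed
    show "V ` carrier H = carrier K"
    proof
      show "carrier K \<subseteq> V ` carrier H"
      proof
        fix y
        assume y: "y \<in> carrier K"
        obtain x where x: "hlimit H (\<lambda>n. adjoint_op H K (U n) y) x"
          using H.hCauchy_imp_hlimit[OF CV[OF y]] by blast
        note [simp] = H.hlimit_in_carrier[OF x]
        have "hnorm K (U n x \<ominus>\<^bsub>K\<^esub> y) = hnorm H (adjoint_op H K (U n) y \<ominus>\<^bsub>H\<^esub> x)" for n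
          using unitary_op_hnorm_diff[OF H K U[of n], of x "adjoint_op H K (U n) y"] y
            unitary_adjoint_right[OF H K U[of n]] H.hnorm_minus_commute[of x "adjoint_op H K (U n) y"]
          by simp
        then have "hlimit K (\<lambda>n. U n x) y"
          using x y U_car by (auto simp: hlimit_def)
        then have "V x = y"
          using V[of x] K.hlimit_unique by simp
        then show "y \<in> V ` carrier H"
          by (metis H.hlimit_in_carrier(2) image_eqI x)
      qed
    qed (use V_car in auto)
  qed
  then show ?thesis
    using V by blast
qed

text \<open>The subsequence is refined a second time, with the two operators interchanged, to make the
  adjoints converge too.\<close>

lemma exists_intertwining_unitary:
  assumes H: "hilbert_space H" "separable_space (htopology H)"
    and K: "hilbert_space K" "separable_space (htopology K)"
    and R: "R \<in> K01 H" and S: "S \<in> K01 K" and U: "\<And>n::nat. unitary_op H K (U n)"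
    and lim: "(\<lambda>n. defect H K R S (U n)) \<longlonglongrightarrow> 0"
  shows "\<exists>V. unitary_op H K V \<and> (\<forall>x\<in>carrier H. S (V x) = V (R x))"
proof -
  interpret H: hilbert_space H by fact
  interpret K: hilbert_space K by fact
  note R = K01D[OF R] and S = K01D[OF S]
  note [simp] = linear_op_in_carrier[OF R(5)] linear_op_in_carrier[OF S(5)]
  note limU = commutator_tendsto_zero[OF H(1) K(1) U R(4) S(4) lim]
  obtain r where r: "strict_mono r" "\<And>x. x \<in> carrier H \<Longrightarrow> hCauchy K (\<lambda>n. U (r n) x)"
    using almost_intertwining_Cauchy_subseq[OF H(1) K(1) H(2) R(4)
        hilbert_space.dense_range_self_adjoint[OF H(1) R(2,3)] S(1) U limU] by blast
  define W where "W n = adjoint_op H K (U (r n))" for n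
  have W: "unitary_op K H (W n)" for n
    unfolding W_def by (rule unitary_op_adjoint[OF H(1) K(1) U])
  note [simp] = unitary_op_in_carrier[OF U] unitary_op_in_carrier[OF W]
  have "(\<lambda>n. defect K H S R (W n)) \<longlonglongrightarrow> 0"
  proof (rule Lim_null_comparison)
    show "(\<lambda>n. defect H K R S (U (r n))) \<longlonglongrightarrow> 0"
      using LIMSEQ_subseq_LIMSEQ[OF lim r(1)] by (simp add: comp_def)
    show "\<forall>\<^sub>F n in sequentially. norm (defect K H S R (W n)) \<le> defect H K R S (U (r n))"
      using defect_adjoint_le[OF H(1) K(1) U R(4) S(4)] defect_nonneg[OF K(1) H(1) W S(4) R(4)]
      by (simp add: W_def)
  qed
  note limW = commutator_tendsto_zero[OF K(1) H(1) W S(4) R(4) this]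
  obtain r' where r': "strict_mono r'" "\<And>y. y \<in> carrier K \<Longrightarrow> hCauchy H (\<lambda>n. W (r' n) y)"
    using almost_intertwining_Cauchy_subseq[OF K(1) H(1) K(2) S(4)
        hilbert_space.dense_range_self_adjoint[OF K(1) S(2,3)] R(1) W limW] by blast
  have "hCauchy K (\<lambda>n. U (r (r' n)) x)" if "x \<in> carrier H" for x
    using K.hCauchy_subseq[OF r(2)[OF that] r'(1)] by (simp add: comp_def)
  then obtain V where V: "unitary_op H K V"
    and V_lim: "\<And>x. x \<in> carrier H \<Longrightarrow> hlimit K (\<lambda>n. U (r (r' n)) x) (V x)"
    using strong_limit_unitary[OF H(1) K(1), of "\<lambda>n. U (r (r' n))"] U r'(2)
    unfolding W_def by blast
  have "S (V x) = V (R x)" if x: "x \<in> carrier H" for x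
  proof -
    have SU: "hlimit K (\<lambda>n. S (U (r (r' n)) x)) (S (V x))"
      by (rule bounded_op_hlimit[OF K(1) K(1) S(4) V_lim[OF x]])
    have close: "(\<lambda>n. hnorm K (S (U (r (r' n)) x) \<ominus>\<^bsub>K\<^esub> U (r (r' n)) (R x))) \<longlonglongrightarrow> 0"
      using LIMSEQ_subseq_LIMSEQ[OF limU[OF x] strict_mono_o[OF r(1) r'(1)]] by (simp add: comp_def)
    have "hlimit K (\<lambda>n. U (r (r' n)) (R x)) (S (V x))"
      by (rule K.hlimit_perturb[OF SU _ close]) (simp add: x)
    moreover have "hlimit K (\<lambda>n. U (r (r' n)) (R x)) (V (R x))"
      by (rule V_lim) (simp add: x)
    ultimately show ?thesis
      by (rule K.hlimit_unique)
  qed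
  then show ?thesis
    using V by blast
qed

section \<open>The distance up to unitary conjugation\<close>

lemma d_uni_eq_INF_defect:
  "d_uni (H, R) (K, S) = (INF U\<in>{U. unitary_op H K U}. defect H K R S U)"
  by (simp add: d_uni_def defect_def)

lemma separable_inf_dim_hilbertD:
  assumes "separable_inf_dim_hilbert H"
  shows "hilbert_space H" "separable_space (htopology H)"
  using assms by (simp_all add: separable_inf_dim_hilbert_def)

lemma d_uni_le_defect:
  assumes "hilbert_space H" "hilbert_space K" "R \<in> K01 H" "S \<in> K01 K" "unitary_op H K U"
  shows "d_uni (H, R) (K, S) \<le> defect H K R S U"
  unfolding d_uni_eq_INF_defect
proof (rule cINF_lower)
  show "bdd_below ((\<lambda>U. defect H K R S U) ` {U. unitary_op H K U})"
    using assms defect_nonneg K01D(4) by (intro bdd_belowI2[of _ 0]) blast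
qed (use assms in simp)

text \<open>The infimum of the empty set of reals carries no information, so the next two facts rest on
  the existence of a unitary between any two spaces of the family.\<close>

lemma d_uni_nonneg:
  assumes H: "separable_inf_dim_hilbert H" and K: "separable_inf_dim_hilbert K"
    and R: "R \<in> K01 H" and S: "S \<in> K01 K"
  shows "0 \<le> d_uni (H, R) (K, S)"
  unfolding d_uni_eq_INF_defect
  using exists_unitary[OF H K] assms defect_nonneg K01D(4) separable_inf_dim_hilbertD(1)
  by (intro cINF_greatest) blast+

lemma exists_defect_less:
  assumes H: "separable_inf_dim_hilbert H" and K: "separable_inf_dim_hilbert K"
    and less: "d_uni (H, R) (K, S) < c"
  shows "\<exists>U. unitary_op H K U \<and> defect H K R S U < c"
proof -
  have "\<exists>x\<in>(\<lambda>U. defect H K R S U) ` {U. unitary_op H K U}. x < c"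
    using less exists_unitary[OF H K] unfolding d_uni_eq_INF_defect
    by (intro cInf_lessD) auto
  then show ?thesis
    by blast
qed

lemma d_uni_eq_0_iff:
  assumes H: "separable_inf_dim_hilbert H" and K: "separable_inf_dim_hilbert K"
    and R: "R \<in> K01 H" and S: "S \<in> K01 K"
  shows "d_uni (H, R) (K, S) = 0 \<longleftrightarrow> unitarily_equivalent (H, R) (K, S)"
proof
  note hilb = separable_inf_dim_hilbertD(1)[OF H] separable_inf_dim_hilbertD(1)[OF K]
  interpret K: hilbert_space K by (rule hilb)
  show "unitarily_equivalent (H, R) (K, S)" if zero: "d_uni (H, R) (K, S) = 0"
  proof -
    have "\<exists>U. unitary_op H K U \<and> defect H K R S U < inverse (real (Suc n))" for n
      using zero by (intro exists_defect_less[OF H K]) simp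
    then obtain U where U: "\<And>n. unitary_op H K (U n)"
      "\<And>n. defect H K R S (U n) < inverse (real (Suc n))"
      by metis
    have "(\<lambda>n. defect H K R S (U n)) \<longlonglongrightarrow> 0"
    proof (rule Lim_null_comparison)
      show "\<forall>\<^sub>F n in sequentially. norm (defect H K R S (U n)) \<le> inverse (real (Suc n))"
        using U(2) defect_nonneg[OF hilb U(1) K01D(4)[OF R] K01D(4)[OF S]] by (simp add: less_imp_le)
    qed (rule LIMSEQ_inverse_real_of_nat)
    then obtain V where V: "unitary_op H K V" "\<forall>x\<in>carrier H. S (V x) = V (R x)"
      using exists_intertwining_unitary[OF separable_inf_dim_hilbertD[OF H]
          separable_inf_dim_hilbertD[OF K] R S, of U] U(1) by blast
    have "S = conj_op H K V R"
      using V eq_conj_op_iff[OF hilb V(1) K01D(5)[OF S]] by blast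
    then show ?thesis
      using V(1) by (auto simp: unitarily_equivalent_def)
  qed
  show "d_uni (H, R) (K, S) = 0" if equiv: "unitarily_equivalent (H, R) (K, S)"
  proof -
    obtain U where U: "unitary_op H K U" "S = conj_op H K U R"
      using equiv by (auto simp: unitarily_equivalent_def)
    then have "S (U x) = U (R x)" if "x \<in> carrier H" for x
      using that eq_conj_op_iff[OF hilb U(1) K01D(5)[OF S]] by blast
    then have "defect H K R S U \<le> 0"
      using linear_op_in_carrier[OF K01D(5)[OF R]] unitary_op_in_carrier[OF U(1)]
      by (intro defect_le[OF hilb U(1) K01D(4)[OF R] K01D(4)[OF S]])
        (simp_all add: K.minus_eq_zero_iff[THEN iffD2])
    then show ?thesis
      using d_uni_le_defect[OF hilb R S U(1)] d_uni_nonneg[OF H K R S] by linarith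
  qed
qed

lemma d_uni_refl:
  assumes H: "separable_inf_dim_hilbert H" and R: "R \<in> K01 H"
  shows "d_uni (H, R) (H, R) = 0"
proof -
  note hilb = separable_inf_dim_hilbertD(1)[OF H]
  let ?I = "\<lambda>x\<in>carrier H. x"
  have "\<forall>x\<in>carrier H. R (?I x) = ?I (R x)"
    using linear_op_in_carrier[OF K01D(5)[OF R]] by simp
  then have "R = conj_op H H ?I R"
    using eq_conj_op_iff[OF hilb hilb unitary_op_id[OF hilb] K01D(5)[OF R]] by blast
  then have "unitarily_equivalent (H, R) (H, R)"
    using unitary_op_id[OF hilb] by (auto simp: unitarily_equivalent_def)
  then show ?thesis
    using d_uni_eq_0_iff[OF H H R R] by simp
qed

lemma d_uni_commute_le:
  assumes H: "separable_inf_dim_hilbert H" and K: "separable_inf_dim_hilbert K"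
    and R: "R \<in> K01 H" and S: "S \<in> K01 K"
  shows "d_uni (K, S) (H, R) \<le> d_uni (H, R) (K, S)"
proof (rule dense_ge)
  note hilb = separable_inf_dim_hilbertD(1)[OF H] separable_inf_dim_hilbertD(1)[OF K]
  fix c
  assume "d_uni (H, R) (K, S) < c"
  then obtain U where U: "unitary_op H K U" "defect H K R S U < c"
    using exists_defect_less[OF H K] by blast
  have "d_uni (K, S) (H, R) \<le> defect K H S R (adjoint_op H K U)"
    by (rule d_uni_le_defect[OF hilb(2,1) S R unitary_op_adjoint[OF hilb U(1)]])
  also have "\<dots> \<le> defect H K R S U"
    by (rule defect_adjoint_le[OF hilb U(1) K01D(4)[OF R] K01D(4)[OF S]])
  finally show "d_uni (K, S) (H, R) \<le> c"
    using U(2) by linarith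
qed

lemma d_uni_triangle:
  assumes H: "separable_inf_dim_hilbert H" and K: "separable_inf_dim_hilbert K"
    and L: "separable_inf_dim_hilbert L"
    and R: "R \<in> K01 H" and S: "S \<in> K01 K" and T: "T \<in> K01 L"
  shows "d_uni (H, R) (L, T) \<le> d_uni (H, R) (K, S) + d_uni (K, S) (L, T)"
proof (rule field_le_epsilon)
  note hilb = separable_inf_dim_hilbertD(1)[OF H] separable_inf_dim_hilbertD(1)[OF K]
    separable_inf_dim_hilbertD(1)[OF L]
  fix e :: real
  assume e: "e > 0"
  obtain U where U: "unitary_op H K U" "defect H K R S U < d_uni (H, R) (K, S) + e / 2"
    using exists_defect_less[OF H K, of R S "d_uni (H, R) (K, S) + e / 2"] e by auto
  obtain V where V: "unitary_op K L V" "defect K L S T V < d_uni (K, S) (L, T) + e / 2"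
    using exists_defect_less[OF K L, of S T "d_uni (K, S) (L, T) + e / 2"] e by auto
  have "d_uni (H, R) (L, T) \<le> defect H L R T (compose (carrier H) V U)"
    by (rule d_uni_le_defect[OF hilb(1,3) R T unitary_op_compose[OF hilb(1) U(1) V(1)]])
  also have "\<dots> \<le> defect H K R S U + defect K L S T V"
    by (rule defect_compose_le[OF hilb U(1) V(1) K01D(4)[OF R] K01D(4)[OF S] K01D(4)[OF T]])
  finally show "d_uni (H, R) (L, T) \<le> d_uni (H, R) (K, S) + d_uni (K, S) (L, T) + e"
    using U(2) V(2) by linarith
qed

text \<open>By the triangle inequality, the distance between chosen representatives does not depend on
  the choice.\<close>

lemma quotient_of_pseudometric:
  fixes d :: "'b \<Rightarrow> 'b \<Rightarrow> real"
  assumes refl: "\<And>p. p \<in> A \<Longrightarrow> d p p = 0"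
    and nonneg: "\<And>p q. p \<in> A \<Longrightarrow> q \<in> A \<Longrightarrow> 0 \<le> d p q"
    and sym: "\<And>p q. p \<in> A \<Longrightarrow> q \<in> A \<Longrightarrow> d p q = d q p"
    and tri: "\<And>p q s. p \<in> A \<Longrightarrow> q \<in> A \<Longrightarrow> s \<in> A \<Longrightarrow> d p s \<le> d p q + d q s"
    and r: "r = {(p, q). p \<in> A \<and> q \<in> A \<and> d p q = 0}"
  shows "\<exists>D. Metric_space (A // r) D \<and> (\<forall>p\<in>A. \<forall>q\<in>A. D (r `` {p}) (r `` {q}) = d p q)"
proof -
  define rep where "rep P = (SOME p. p \<in> P)" for P :: "'b set"
  \<comment> \<open>\<open>Metric_space\<close> demands symmetry and non-negativity off its carrier as well.\<close>
  define D where "D P Q = (if P \<in> A // r \<and> Q \<in> A // r then d (rep P) (rep Q) else 0)" for P Q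
  have rep: "rep (r `` {p}) \<in> A \<and> d p (rep (r `` {p})) = 0" if p: "p \<in> A" for p
  proof -
    have "p \<in> r `` {p}"
      using p refl by (simp add: r)
    then have "rep (r `` {p}) \<in> r `` {p}"
      unfolding rep_def by (rule someI)
    then show ?thesis
      by (auto simp: r)
  qed
  have D: "D (r `` {p}) (r `` {q}) = d p q" if pq: "p \<in> A" "q \<in> A" for p q
  proof -
    let ?p = "rep (r `` {p})" and ?q = "rep (r `` {q})"
    have in_A: "?p \<in> A" "?q \<in> A" and zero: "d p ?p = 0" "d q ?q = 0" "d ?p p = 0" "d ?q q = 0"
      using rep[OF pq(1)] rep[OF pq(2)] sym pq by auto
    have "d p q = d ?p ?q"
      using tri[of p ?p q] tri[of ?p ?q q] tri[of ?p p ?q] tri[of p q ?q] in_A zero pq by linarith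
    then show ?thesis
      using pq by (simp add: D_def quotientI)
  qed
  have classes: "\<exists>p\<in>A. P = r `` {p}" if "P \<in> A // r" for P
    using that by (auto elim: quotientE)
  have "Metric_space (A // r) D"
  proof
    fix P Q
    have "rep P \<in> A" if "P \<in> A // r" for P
      using classes[OF that] rep by auto
    then show "0 \<le> D P Q" "D P Q = D Q P"
      using nonneg sym by (auto simp: D_def)
  next
    fix P Q
    assume "P \<in> A // r" "Q \<in> A // r"
    then obtain p q where pq: "p \<in> A" "P = r `` {p}" "q \<in> A" "Q = r `` {q}"
      using classes by blast
    have "r `` {p} = r `` {q}" if "d p q = 0"
    proof -
      have "d p s = d q s" if "s \<in> A" for s
        using tri[of p q s] tri[of q p s] sym[of q p] \<open>d p q = 0\<close> pq that by simp
      then show ?thesis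
        using pq by (auto simp: r)
    qed
    moreover have "d p q = 0" if "r `` {p} = r `` {q}"
      using that pq refl by (auto simp: r)
    ultimately show "D P Q = 0 \<longleftrightarrow> P = Q"
      using pq D by auto
  next
    fix P Q W
    assume "P \<in> A // r" "Q \<in> A // r" "W \<in> A // r"
    then obtain p q s where "p \<in> A" "P = r `` {p}" "q \<in> A" "Q = r `` {q}" "s \<in> A" "W = r `` {s}"
      using classes by meson
    then show "D P W \<le> D P Q + D Q W"
      using tri D by simp
  qed
  then show ?thesis
    using D by blast
qed

theorem proposition2p6:
  fixes HS :: "'a hilbert set"
  assumes "\<forall>H\<in>HS. separable_inf_dim_hilbert H"
  shows "(\<forall>p\<in>K01_all HS. \<forall>q\<in>K01_all HS. d_uni p q = 0 \<longleftrightarrow> unitarily_equivalent p q) \<and>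
    (\<exists>D. Metric_space (K01_classes HS) D \<and>
       (\<forall>p\<in>K01_all HS. \<forall>q\<in>K01_all HS.
          D (unitary_rel HS `` {p}) (unitary_rel HS `` {q}) = d_uni p q))"
proof
  have sep: "separable_inf_dim_hilbert (fst p) \<and> snd p \<in> K01 (fst p)" if "p \<in> K01_all HS" for p
    using that assms by (auto simp: K01_all_def)
  have iff: "d_uni p q = 0 \<longleftrightarrow> unitarily_equivalent p q"
    if "p \<in> K01_all HS" "q \<in> K01_all HS" for p q
    using d_uni_eq_0_iff[of "fst p" "fst q" "snd p" "snd q"] sep[OF that(1)] sep[OF that(2)] by simp
  then show "\<forall>p\<in>K01_all HS. \<forall>q\<in>K01_all HS. d_uni p q = 0 \<longleftrightarrow> unitarily_equivalent p q"
    by blast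
  show "\<exists>D. Metric_space (K01_classes HS) D \<and>
      (\<forall>p\<in>K01_all HS. \<forall>q\<in>K01_all HS.
        D (unitary_rel HS `` {p}) (unitary_rel HS `` {q}) = d_uni p q)"
    unfolding K01_classes_def
  proof (rule quotient_of_pseudometric)
    fix p q
    assume pq: "p \<in> K01_all HS" "q \<in> K01_all HS"
    show "0 \<le> d_uni p q"
      using d_uni_nonneg[of "fst p" "fst q" "snd p" "snd q"] sep pq by simp
    show "d_uni p q = d_uni q p"
      using d_uni_commute_le[of "fst p" "fst q" "snd p" "snd q"]
        d_uni_commute_le[of "fst q" "fst p" "snd q" "snd p"] sep pq by simp
    fix s
    assume "s \<in> K01_all HS"
    then show "d_uni p s \<le> d_uni p q + d_uni q s"
      using d_uni_triangle[of "fst p" "fst q" "fst s" "snd p" "snd q" "snd s"] sep pq by simp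
  next
    show "d_uni p p = 0" if "p \<in> K01_all HS" for p
      using d_uni_refl[of "fst p" "snd p"] sep[OF that] by simp
    show "unitary_rel HS = {(p, q). p \<in> K01_all HS \<and> q \<in> K01_all HS \<and> d_uni p q = 0}"
      using iff by (auto simp: unitary_rel_def)
  qed
qed

end
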